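(* Let $\{x^k\}_{k\ge 0}$ be generated by the accelerated proximal gradient method described in the context, with parameters $a\in(0,1)$, $b\in[a^2/4,1/4]$, $\ell\ge L$ and starting point $x^0\in\operatorname{dom}F$. Then, under Assumption (B) stated in the context, the following hold: (i) $\{x^k\}$ is bounded, and it has an accumulation point; (ii) $\{x^k\}$ converges to a weakly Pareto optimal point of $F$, i.e. to a point of $X^\ast$.
   Context: Setting: $m\ge 1$, $F=(F_1,\dots,F_m)^\top:\mathbf{R}^n\to(\mathbf{R}\cup\{\infty\})^m$ with $F_i=f_i+g_i$, where each $f_i:\mathbf{R}^n\to\mathbf{R}$ is convex and continuously differentiable with $\nabla f_i$ Lipschitz continuous with constant $L_i>0$, and each $g_i:\mathbf{R}^n\to\mathbf{R}\cup\{\infty\}$ is closed, proper and convex. Put $L:=\max_i L_i$. The norm is Euclidean. For vectors, $v^1\le v^2$ (resp. $v^1<v^2$) means $v^1_i\le v^2_i$ (resp. $v^1_i<v^2_i$) for every $i$. $\operatorname{dom}F:=\{x: F(x)<\infty\}$ (all components finite). Weakly Pareto optimal set: $X^\ast:=\{x^\ast\in\mathbf{R}^n : \text{there is no } x\in\mathbf{R}^n \text{ with } F(x)<F(x^\ast)\}$. Level set: $\mathcal{L}_F(c):=\{x\in\mathbf{R}^n: F(x)\le c\}$. $F(A)$ and $F^{-1}(B)$ denote image and inverse image. Algorithm: for $\ell\ge L$, $x\in\operatorname{dom}F$, $y\in\mathbf{R}^n$ let $p_\ell(x,y)$ be the unique minimizer over $z\in\mathbf{R}^n$ of $$\max_{i=1,\dots,m}\big[\langle\nabla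 f_i(y),z-y\rangle+g_i(z)+f_i(y)-F_i(x)\big]+\tfrac{\ell}{2}\|z-y\|^2 .$$ Given $a,b$, set $x^0=y^1\in\operatorname{dom}F$, $t_1=1$ and for $k=1,2,\dots$ $$x^k=p_\ell(x^{k-1},y^k),\quad t_{k+1}=\sqrt{t_k^2-at_k+b}+\tfrac12,\quad \gamma_k=\frac{t_k-1}{t_{k+1}},\quad y^{k+1}=x^k+\gamma_k(x^k-x^{k-1}).$$ The generated sequences are infinite (no stopping test). Assumption (B): for every $x\in\mathcal{L}_F(F(x^0))$ there exists $x^\ast\in X^\ast$ with $F(x^\ast)\le F(x)$, and $$R:=\sup_{F^\ast\in F(X^\ast\cap\mathcal{L}_F(F(x^0)))}\ \inf_{z\in F^{-1}(\{F^\ast\})}\|z-x^0\|^2<\infty .$$ *)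

theory Defs
  imports "HOL-Analysis.Analysis"
begin

definition ereal_epigraph :: "('a \<Rightarrow> ereal) \<Rightarrow> ('a \<times> real) set" where
  "ereal_epigraph h = {(x, r). h x \<le> ereal r}"

definition proper_fun :: "('a \<Rightarrow> ereal) \<Rightarrow> bool" where
  "proper_fun h \<longleftrightarrow> (\<forall>x. h x \<noteq> -\<infinity>) \<and> (\<exists>x. h x \<noteq> \<infinity>)"

definition closed_fun :: "('a::topological_space \<Rightarrow> ereal) \<Rightarrow> bool" where
  "closed_fun h \<longleftrightarrow> closed (ereal_epigraph h)"

definition convex_fun :: "('a::real_vector \<Rightarrow> ereal) \<Rightarrow> bool" where
  "convex_fun h \<longleftrightarrow> convex (ereal_epigraph h)"

text \<open>The objectives are indexed by a finite type \<open>'m\<close>. On \<open>'m \<Rightarrow> ereal\<close> the library's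
  \<open>\<le>\<close> is the componentwise order; its \<open><\<close> is not the componentwise strict order, which
  is therefore defined separately.\<close>

definition strict_all :: "('m \<Rightarrow> ereal) \<Rightarrow> ('m \<Rightarrow> ereal) \<Rightarrow> bool" where
  "strict_all u v \<longleftrightarrow> (\<forall>i. u i < v i)"

definition objective :: "('m \<Rightarrow> 'a \<Rightarrow> real) \<Rightarrow> ('m \<Rightarrow> 'a \<Rightarrow> ereal) \<Rightarrow> 'a \<Rightarrow> 'm \<Rightarrow> ereal" where
  "objective f g x = (\<lambda>i. ereal (f i x) + g i x)"

definition domain :: "('a \<Rightarrow> 'm \<Rightarrow> ereal) \<Rightarrow> 'a set" where
  "domain F = {x. \<forall>i. F x i < \<infinity>}"

definition weakly_pareto :: "('a \<Rightarrow> 'm \<Rightarrow> ereal) \<Rightarrow> 'a set" where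
  "weakly_pareto F = {xs. \<not> (\<exists>x. strict_all (F x) (F xs))}"

definition level_set :: "('a \<Rightarrow> 'm \<Rightarrow> ereal) \<Rightarrow> ('m \<Rightarrow> ereal) \<Rightarrow> 'a set" where
  "level_set F c = {x. F x \<le> c}"

text \<open>Here \<open>df i\<close> is the gradient of \<open>f i\<close>. Subtracting \<open>objective f g x i\<close> is meaningful
  for \<open>x\<close> in the domain, where all its components are finite.\<close>

definition subproblem ::
  "('m::finite \<Rightarrow> 'a::euclidean_space \<Rightarrow> real) \<Rightarrow> ('m \<Rightarrow> 'a \<Rightarrow> 'a) \<Rightarrow> ('m \<Rightarrow> 'a \<Rightarrow> ereal)
    \<Rightarrow> real \<Rightarrow> 'a \<Rightarrow> 'a \<Rightarrow> 'a \<Rightarrow> ereal" where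
  "subproblem f df g l x y z =
     (MAX i. ereal (df i y \<bullet> (z - y)) + g i z + ereal (f i y) - objective f g x i)
       + ereal (l / 2 * (norm (z - y))\<^sup>2)"

definition prox_step ::
  "('m::finite \<Rightarrow> 'a::euclidean_space \<Rightarrow> real) \<Rightarrow> ('m \<Rightarrow> 'a \<Rightarrow> 'a) \<Rightarrow> ('m \<Rightarrow> 'a \<Rightarrow> ereal)
    \<Rightarrow> real \<Rightarrow> 'a \<Rightarrow> 'a \<Rightarrow> 'a" where
  "prox_step f df g l x y = (THE z. is_arg_min (subproblem f df g l x y) (\<lambda>_. True) z)"

text \<open>The sequences \<open>y\<close> and \<open>t\<close> start at index 1; their values at 0 are irrelevant.\<close>

definition accelerated_prox_grad ::
  "('m::finite \<Rightarrow> 'a::euclidean_space \<Rightarrow> real) \<Rightarrow> ('m \<Rightarrow> 'a \<Rightarrow> 'a) \<Rightarrow> ('m \<Rightarrow> 'a \<Rightarrow> ereal)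
    \<Rightarrow> real \<Rightarrow> real \<Rightarrow> real \<Rightarrow> (nat \<Rightarrow> 'a) \<Rightarrow> (nat \<Rightarrow> 'a) \<Rightarrow> (nat \<Rightarrow> real) \<Rightarrow> bool" where
  "accelerated_prox_grad f df g l a b x y t \<longleftrightarrow>
     x 0 \<in> domain (objective f g) \<and> y 1 = x 0 \<and> t 1 = 1 \<and>
     (\<forall>k\<ge>1. x k = prox_step f df g l (x (k - 1)) (y k) \<and>
            t (k + 1) = sqrt ((t k)\<^sup>2 - a * t k + b) + 1 / 2 \<and>
            y (k + 1) = x k + ((t k - 1) / t (k + 1)) *\<^sub>R (x k - x (k - 1)))"

definition assumption_B :: "('a::real_normed_vector \<Rightarrow> 'm \<Rightarrow> ereal) \<Rightarrow> 'a \<Rightarrow> bool" where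
  "assumption_B F x0 \<longleftrightarrow>
     (\<forall>x\<in>level_set F (F x0). \<exists>xs\<in>weakly_pareto F. F xs \<le> F x) \<and>
     (SUP Fs\<in>F ` (weakly_pareto F \<inter> level_set F (F x0)).
        INF z\<in>F -` {Fs}. ereal ((norm (z - x0))\<^sup>2)) < \<infinity>"

end

theory Submission
  imports Defs
begin

text \<open>
  The theorem holds because the iteration has an energy that eventually decreases for every
  comparison point at once. Write \<open>F\<close> for the objectives, \<open>\<Delta>\<^sub>k\<close> for the square of \<open>norm (x\<^sup>k - x\<^sup>k\<^sup>-\<^sup>1)\<close> and
  \<open>\<sigma>\<^sub>k(z)\<close> for the minimum over \<open>i\<close> of \<open>F\<^sub>i(x\<^sup>k) - F\<^sub>i(z)\<close>.

  The proximal subproblem is strongly convex, so its value at any \<open>z\<close> exceeds the minimum by at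
  least \<open>l / 2\<close> times the squared distance from the minimiser. Together with convexity of the \<open>f\<^sub>i\<close> and
  the descent lemma this yields one inequality (\<open>prox_step_descent\<close>) that bounds the new objective
  values through those at \<open>z\<close>. Taking \<open>z\<close> to be the previous iterate, or arbitrary, gives the two
  inequalities from which everything else follows; they are the assumptions of the locale
  \<open>accelerated_descent\<close>.

  With weights \<open>t\<^sub>k\<close> these combine to the familiar energy
  \<open>t\<^sub>k\<^sup>2 \<sigma>\<^sub>k(z) + l / 2 * (norm (u\<^sub>k - z))\<^sup>2\<close>, which decreases up to \<open>- c\<^sub>k \<sigma>\<^sub>k(z)\<close>, where \<open>c\<^sub>k\<close> is about \<open>a t\<^sub>k\<close>. For
  \<open>a > 0\<close> that term cannot be dropped, because \<open>\<sigma>\<^sub>k(z)\<close> may be negative. It is absorbed by adding a growing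
  multiple \<open>s\<^sub>k = c\<^sub>1 + \<dots> + c\<^sub>k\<^sub>-\<^sub>1\<close> of the inertial energy \<open>\<sigma>\<^sub>k(z) + l / 2 * \<Delta>\<^sub>k\<close>, which is itself nonincreasing. The
  resulting energy \<open>G\<close> loses, for every \<open>z\<close> in the domain, at least a fixed positive multiple of \<open>t\<^sub>k \<Delta>\<^sub>k\<close> in
  every step with \<open>k\<close> large enough (\<open>dissipation_ge\<close>, \<open>energy_bound\<close>); this gain, which requires \<open>a > 0\<close>, is
  what makes the whole sequence converge.

  Evaluating \<open>G\<^sub>k\<close> at a point that dominates \<open>x\<^sup>k\<close> and lies within bounded distance of \<open>x\<^sup>0\<close> shows that the
  iterates are bounded and that the sum of all \<open>t\<^sub>k \<Delta>\<^sub>k\<close> is finite. For an accumulation point the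
  squared distance from the iterates then satisfies an inertial inequality with summable errors, so
  it converges, necessarily to zero (\<open>distance_convergent\<close>). Finally \<open>t\<^sub>k \<rightarrow> \<infinity>\<close> in the energy bound
  excludes a point that improves every objective of the limit (\<open>limit_not_dominated\<close>).
\<close>

section \<open>Proximal minimisation over a closed convex epigraph\<close>

text \<open>If the bound failed for every \<open>M\<close>, then \<open>E\<close> would contain points below arbitrarily steep cones under
  \<open>(x, r0)\<close>. Sliding along the segment from \<open>(x, r0)\<close> to such a point until the height has dropped by
  one moves \<open>x\<close> arbitrarily little, so closedness would put \<open>(x, r0 - 1)\<close> into \<open>E\<close>. This gives
  coercivity of convex lower semicontinuous functions without a separating hyperplane.\<close>

lemma closed_convex_below_growth:
  fixes E :: "('a::real_normed_vector \<times> real) set"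
  assumes "closed E" "convex E" and in_E: "(x, r0) \<in> E" and out_E: "(x, r0 - 1) \<notin> E"
  shows "\<exists>M\<ge>0. \<forall>z r. (z, r) \<in> E \<longrightarrow> r0 - M * (1 + norm (z - x)) \<le> r"
proof (rule ccontr)
  assume "\<not> ?thesis"
  then have "\<forall>n. \<exists>z r. (z, r) \<in> E \<and> r < r0 - real (Suc n) * (1 + norm (z - x))"
    by (metis not_le of_nat_0_le_iff)
  then obtain z r where zr: "\<And>n. (z n, r n) \<in> E"
    and below: "\<And>n. r n < r0 - real (Suc n) * (1 + norm (z n - x))"
    by metis
  \<comment> \<open>the fraction of the segment at which the height has dropped by exactly one\<close>
  define q where "q n = 1 / (r0 - r n)" for n
  have gap: "real (Suc n) * (1 + norm (z n - x)) < r0 - r n" for n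
    using below[of n] by linarith
  have "real (Suc n) \<le> real (Suc n) * (1 + norm (z n - x))" for n
    using mult_left_mono[of 1 "1 + norm (z n - x)" "real (Suc n)"] by simp
  then have gap_pos: "1 < r0 - r n" for n
    using gap[of n] by (smt (verit) of_nat_0_le_iff of_nat_Suc)
  have q_pos: "0 < q n" and q_less: "q n < 1" for n
    using gap_pos[of n] by (auto simp: q_def)
  have mem: "(x + q n *\<^sub>R (z n - x), r0 - 1) \<in> E" for n
  proof -
    have "(1 - q n) *\<^sub>R (x, r0) + q n *\<^sub>R (z n, r n) \<in> E"
      using convexD[OF \<open>convex E\<close> in_E zr[of n], of "1 - q n" "q n"] q_pos[of n] q_less[of n]
      by simp
    moreover have "q n * (r0 - r n) = 1"
      using gap_pos[of n] by (simp add: q_def)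
    then have "(1 - q n) * r0 + q n * r n = r0 - 1"
      by (simp add: algebra_simps)
    moreover have "(1 - q n) *\<^sub>R (x, r0) + q n *\<^sub>R (z n, r n)
        = (x + q n *\<^sub>R (z n - x), (1 - q n) * r0 + q n * r n)"
      by (simp add: algebra_simps)
    ultimately show ?thesis
      by simp
  qed
  have small: "norm (q n *\<^sub>R (z n - x)) \<le> inverse (real (Suc n))" for n
  proof -
    have "real (Suc n) * norm (z n - x) \<le> r0 - r n"
      using gap[of n] by (simp add: algebra_simps)
    then show ?thesis
      using gap_pos[of n] by (simp add: q_def divide_simps mult.commute)
  qed
  have "(\<lambda>n. q n *\<^sub>R (z n - x)) \<longlonglongrightarrow> 0"
    by (rule Lim_null_comparison[OF _ LIMSEQ_inverse_real_of_nat]) (use small in auto)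
  then have "(\<lambda>n. (x + q n *\<^sub>R (z n - x), r0 - 1)) \<longlonglongrightarrow> (x + 0, r0 - 1)"
    by (intro tendsto_intros)
  then have "(x + 0, r0 - 1) \<in> E"
    by (rule closed_sequentially[OF \<open>closed E\<close> mem])
  then show False
    using out_E by simp
qed

text \<open>A proximal step on a function with epigraph \<open>E\<close> minimises \<open>r + l / 2 * (norm (z - y))\<^sup>2\<close> over
  \<open>(z, r) \<in> E\<close>. Working on the epigraph keeps the objective continuous and real-valued; the quadratic
  beats the at most linear descent of \<open>E\<close>, so the sublevel sets are compact.\<close>

lemma prox_min_exists:
  fixes E :: "('a::euclidean_space \<times> real) set"
  assumes E: "closed E" "convex E" and in_E: "(x, r0) \<in> E" and out_E: "(x, r0 - 1) \<notin> E"
    and l: "0 < (l::real)"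
  shows "\<exists>p s. (p, s) \<in> E \<and>
    (\<forall>z r. (z, r) \<in> E \<longrightarrow> s + l / 2 * (norm (p - y))\<^sup>2 \<le> r + l / 2 * (norm (z - y))\<^sup>2)"
proof -
  obtain M where M: "0 \<le> M" "\<And>z r. (z, r) \<in> E \<Longrightarrow> r0 - M * (1 + norm (z - x)) \<le> r"
    using closed_convex_below_growth[OF assms(1-4)] by blast
  define \<psi> where "\<psi> w = snd w + l / 2 * (norm (fst w - y))\<^sup>2" for w :: "'a \<times> real"
  \<comment> \<open>on the sublevel set of \<open>(x, r0)\<close> the quadratic term is at most \<open>C + M * norm (z - y)\<close>, which forces \<open>norm (z - y) \<le> B\<close>\<close>
  define C where "C = \<bar>\<psi> (x, r0) - r0 + M * (1 + norm (y - x))\<bar>"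
  define B where "B = 1 + 2 * (C + M) / l"
  define S where "S = E \<inter> {w. \<psi> w \<le> \<psi> (x, r0)}"
  have cont: "continuous_on UNIV \<psi>"
    unfolding \<psi>_def by (intro continuous_intros)
  have bound: "norm (z - y) \<le> B \<and> r0 - M * (1 + B + norm (y - x)) \<le> r \<and> r \<le> \<psi> (x, r0)"
    if "(z, r) \<in> S" for z r
  proof -
    have zr: "(z, r) \<in> E" and le: "r + l / 2 * (norm (z - y))\<^sup>2 \<le> \<psi> (x, r0)"
      using that by (auto simp: S_def \<psi>_def)
    have tri: "norm (z - x) \<le> norm (z - y) + norm (y - x)"
      using norm_triangle_ineq[of "z - y" "y - x"] by simp
    then have Mtri: "M * (1 + norm (z - x)) \<le> M * (1 + norm (z - y) + norm (y - x))"
      by (intro mult_left_mono) (use M in auto)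
    have quad: "l / 2 * (norm (z - y))\<^sup>2 \<le> C + M * norm (z - y)"
    proof -
      have "\<psi> (x, r0) - r0 + M * (1 + norm (y - x)) \<le> C"
        unfolding C_def by (rule abs_ge_self)
      then show ?thesis
        using M(2)[OF zr] le Mtri by (simp add: distrib_left)
    qed
    have n: "norm (z - y) \<le> B"
    proof (rule ccontr)
      assume "\<not> ?thesis"
      then have big: "B < norm (z - y)" by simp
      have C0: "0 \<le> C" by (simp add: C_def)
      have B1: "1 \<le> B" using M l C0 by (simp add: B_def)
      have "C + M \<le> l / 2 * B" using l by (simp add: B_def field_simps)
      also have "\<dots> < l / 2 * norm (z - y)" using big l by simp
      finally have "(C + M) * norm (z - y) < l / 2 * norm (z - y) * norm (z - y)"
        using big B1 by (intro mult_strict_right_mono) auto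
      moreover have "C \<le> C * norm (z - y)"
        using C0 big B1 mult_left_mono[of 1 "norm (z - y)" C] by simp
      ultimately show False
        using quad by (simp add: power2_eq_square algebra_simps)
    qed
    have "M * (1 + norm (z - y) + norm (y - x)) \<le> M * (1 + B + norm (y - x))"
      by (intro mult_left_mono) (use M n in auto)
    moreover have "r \<le> \<psi> (x, r0)"
      using le l by (smt (verit) divide_pos_pos mult_nonneg_nonneg zero_le_power2)
    ultimately show ?thesis
      using n M(2)[OF zr] Mtri by linarith
  qed
  have "S \<subseteq> cball y B \<times> {r0 - M * (1 + B + norm (y - x))..\<psi> (x, r0)}"
    using bound by (auto simp: dist_norm norm_minus_commute)
  then have "bounded S"
    by (rule bounded_subset[rotated]) (intro bounded_Times bounded_cball bounded_closed_interval)
  moreover have "closed S"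
    unfolding S_def using E cont by (intro closed_Int closed_Collect_le) auto
  moreover have "(x, r0) \<in> S"
    using in_E by (simp add: S_def)
  ultimately obtain w where w: "w \<in> S" "\<And>v. v \<in> S \<Longrightarrow> \<psi> w \<le> \<psi> v"
    using continuous_attains_inf[of S \<psi>] cont
    by (metis compact_eq_bounded_closed continuous_on_subset empty_iff subset_UNIV)
  have "\<psi> w \<le> \<psi> v" if "v \<in> E" for v
    using w(2)[of v] w(2)[OF \<open>(x, r0) \<in> S\<close>] that by (cases "v \<in> S") (auto simp: S_def)
  then show ?thesis
    using w(1) by (intro exI[of _ "fst w"] exI[of _ "snd w"]) (auto simp: \<psi>_def S_def)
qed

text \<open>Strong convexity at the minimiser: the first-order condition along the segment towards
  \<open>(z, r)\<close> says that the linear part of the increment is nonnegative, and what remains of the square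
  is \<open>l / 2 * (norm (z - p))\<^sup>2\<close>. It yields uniqueness of the minimiser as well as the basic inequality of
  the method.\<close>

lemma prox_min_three_point:
  fixes E :: "('a::real_inner \<times> real) set"
  assumes "convex E" "(p, s) \<in> E" "(z, r) \<in> E"
    and min: "\<And>z r. (z, r) \<in> E \<Longrightarrow> s + l / 2 * (norm (p - y))\<^sup>2 \<le> r + l / 2 * (norm (z - y))\<^sup>2"
  shows "s + l / 2 * (norm (p - y))\<^sup>2 + l / 2 * (norm (z - p))\<^sup>2 \<le> r + l / 2 * (norm (z - y))\<^sup>2"
proof -
  have "0 \<le> (r - s) + l * ((p - y) \<bullet> (z - p)) + q * (l / 2 * (norm (z - p))\<^sup>2)"
    if q: "0 < q" "q < 1" for q
  proof -
    have "(1 - q) *\<^sub>R (p, s) + q *\<^sub>R (z, r) \<in> E"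
      using convexD[OF assms(1-3), of "1 - q" q] q by simp
    then have "(p + q *\<^sub>R (z - p), s + q * (r - s)) \<in> E"
      by (simp add: algebra_simps)
    from min[OF this] have "s + l / 2 * (norm (p - y))\<^sup>2
        \<le> s + q * (r - s) + l / 2 * (norm ((p - y) + q *\<^sub>R (z - p)))\<^sup>2"
      by (simp add: algebra_simps)
    also have "(norm ((p - y) + q *\<^sub>R (z - p)))\<^sup>2
        = (norm (p - y))\<^sup>2 + 2 * q * ((p - y) \<bullet> (z - p)) + q\<^sup>2 * (norm (z - p))\<^sup>2"
      by (simp only: power2_norm_eq_inner)
        (simp add: inner_add_left inner_add_right inner_commute power2_eq_square algebra_simps)
    finally have "0 \<le> q * ((r - s) + l * ((p - y) \<bullet> (z - p)) + q * (l / 2 * (norm (z - p))\<^sup>2))"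
      by (simp add: algebra_simps power2_eq_square)
    then show ?thesis
      using q by (simp add: zero_le_mult_iff)
  qed
  then have "\<forall>\<^sub>F q in at_right 0.
      0 \<le> (r - s) + l * ((p - y) \<bullet> (z - p)) + q * (l / 2 * (norm (z - p))\<^sup>2)"
    using eventually_at_right_real[of 0 "1::real"] by (auto elim: eventually_mono)
  moreover have "((\<lambda>q. (r - s) + l * ((p - y) \<bullet> (z - p)) + q * (l / 2 * (norm (z - p))\<^sup>2))
      \<longlongrightarrow> (r - s) + l * ((p - y) \<bullet> (z - p)) + 0 * (l / 2 * (norm (z - p))\<^sup>2)) (at_right 0)"
    by (intro tendsto_intros)
  ultimately have "0 \<le> (r - s) + l * ((p - y) \<bullet> (z - p)) + 0 * (l / 2 * (norm (z - p))\<^sup>2)"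
    by (intro tendsto_lowerbound) auto
  then have slope: "0 \<le> (r - s) + l * ((p - y) \<bullet> (z - p))"
    by simp
  have expand: "(norm (z - y))\<^sup>2
      = (norm (p - y))\<^sup>2 + 2 * ((p - y) \<bullet> (z - p)) + (norm (z - p))\<^sup>2"
    by (simp only: power2_norm_eq_inner)
      (simp add: inner_diff_left inner_diff_right inner_commute)
  have "l / 2 * (norm (z - y))\<^sup>2
      = l / 2 * (norm (p - y))\<^sup>2 + l * ((p - y) \<bullet> (z - p)) + l / 2 * (norm (z - p))\<^sup>2"
    by (subst expand) (simp add: distrib_left)
  from this slope show ?thesis
    by linarith
qed

section \<open>Gradient bounds for convex and smooth functions\<close>

text \<open>Restriction to a line reduces the two gradient bounds below to one real variable.\<close>

lemma GDERIV_line: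
  assumes "\<And>z. GDERIV f z :> df z"
  shows "((\<lambda>s. f (y + s *\<^sub>R v)) has_real_derivative df (y + s *\<^sub>R v) \<bullet> v) (at s within A)"
proof -
  have "((\<lambda>s. y + s *\<^sub>R v) has_derivative (\<lambda>h. h *\<^sub>R v)) (at s within A)"
    by (auto intro!: derivative_eq_intros)
  from has_derivative_compose[OF this] assms[unfolded gderiv_def]
  have "((\<lambda>s. f (y + s *\<^sub>R v)) has_derivative (\<lambda>h. (h *\<^sub>R v) \<bullet> df (y + s *\<^sub>R v))) (at s within A)"
    by blast
  then show ?thesis
    by (simp add: has_field_derivative_def inner_commute mult_commute_abs)
qed

lemma convex_gradient_below:
  assumes "convex_on UNIV f" and "\<And>z. GDERIV f z :> df z"
  shows "f y + df y \<bullet> (z - y) \<le> f z"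
proof -
  have "convex_on UNIV (\<lambda>s. f (y + s *\<^sub>R (z - y)))"
  proof (rule convex_onI)
    fix q u v :: real
    assume "0 < q" "q < 1"
    then have "f ((1 - q) *\<^sub>R (y + u *\<^sub>R (z - y)) + q *\<^sub>R (y + v *\<^sub>R (z - y)))
        \<le> (1 - q) * f (y + u *\<^sub>R (z - y)) + q * f (y + v *\<^sub>R (z - y))"
      by (intro convex_onD[OF assms(1)]) auto
    moreover have "(1 - q) *\<^sub>R (y + u *\<^sub>R (z - y)) + q *\<^sub>R (y + v *\<^sub>R (z - y))
        = y + ((1 - q) *\<^sub>R u + q *\<^sub>R v) *\<^sub>R (z - y)"
      by (simp add: algebra_simps)
    ultimately show "f (y + ((1 - q) *\<^sub>R u + q *\<^sub>R v) *\<^sub>R (z - y))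
        \<le> (1 - q) * f (y + u *\<^sub>R (z - y)) + q * f (y + v *\<^sub>R (z - y))"
      by simp
  qed auto
  from convex_on_imp_above_tangent[OF this, of 0 1 "df y \<bullet> (z - y)"]
    GDERIV_line[OF assms(2), of y "z - y" 0 UNIV]
  show ?thesis by simp
qed

lemma lipschitz_gradient_above:
  assumes "\<And>z. GDERIV f z :> df z" and "L-lipschitz_on UNIV df"
  shows "f z \<le> f y + df y \<bullet> (z - y) + L / 2 * (norm (z - y))\<^sup>2"
proof -
  define v where "v = z - y"
  define h where "h s = f (y + s *\<^sub>R v) - s * (df y \<bullet> v) - L / 2 * s\<^sup>2 * (norm v)\<^sup>2" for s
  have "h 1 \<le> h 0"
  proof (rule DERIV_nonpos_imp_nonincreasing[of 0 1 h])
    fix s :: real assume s: "0 \<le> s" "s \<le> 1"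
    have "(h has_real_derivative df (y + s *\<^sub>R v) \<bullet> v - df y \<bullet> v - L * s * (norm v)\<^sup>2) (at s)"
      unfolding h_def
      by (auto intro!: derivative_eq_intros GDERIV_line[OF assms(1)])
    moreover have "(df (y + s *\<^sub>R v) - df y) \<bullet> v \<le> norm (df (y + s *\<^sub>R v) - df y) * norm v"
      by (rule norm_cauchy_schwarz)
    moreover have "norm (df (y + s *\<^sub>R v) - df y) \<le> L * (s * norm v)"
      using lipschitz_onD[OF assms(2), of "y + s *\<^sub>R v" y] s by (simp add: dist_norm)
    then have "norm (df (y + s *\<^sub>R v) - df y) * norm v \<le> L * (s * norm v) * norm v"
      by (intro mult_right_mono) auto
    ultimately show "\<exists>D. (h has_real_derivative D) (at s) \<and> D \<le> 0"
      by (intro exI[of _ "df (y + s *\<^sub>R v) \<bullet> v - df y \<bullet> v - L * s * (norm v)\<^sup>2"])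
        (simp add: inner_diff_left power2_eq_square algebra_simps)
  qed simp
  then show ?thesis
    by (simp add: h_def v_def)
qed

section \<open>The proximal subproblem\<close>

lemma Max_range_attained:
  fixes h :: "'i::finite \<Rightarrow> 'b::linorder"
  obtains i where "(MAX j. h j) = h i"
proof -
  have "(MAX j. h j) \<in> range h"
    by (rule Max_in) auto
  then show ?thesis
    by (rule rangeE) (rule that)
qed

text \<open>Inside the domain everything is real arithmetic on \<open>fval\<close>; outside it, where \<open>g i z = \<infinity>\<close>, the
  value \<open>f i z\<close> that \<open>real_of_ereal\<close> produces is meaningless.\<close>

definition fval :: "('m \<Rightarrow> 'a \<Rightarrow> real) \<Rightarrow> ('m \<Rightarrow> 'a \<Rightarrow> ereal) \<Rightarrow> 'm \<Rightarrow> 'a \<Rightarrow> real" where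
  "fval f g i z = f i z + real_of_ereal (g i z)"

lemma domain_objective_iff: "z \<in> domain (objective f g) \<longleftrightarrow> (\<forall>i. g i z < \<infinity>)"
  by (auto simp: domain_def objective_def)

lemma g_eq_fval:
  assumes "\<And>i. proper_fun (g i)" "z \<in> domain (objective f g)"
  shows "g i z = ereal (fval f g i z - f i z)"
  using assms unfolding domain_objective_iff proper_fun_def fval_def
  by (cases "g i z") (auto simp: less_top)

lemma objective_eq_fval:
  assumes "\<And>i. proper_fun (g i)" "z \<in> domain (objective f g)"
  shows "objective f g z i = ereal (fval f g i z)"
  by (simp add: objective_def g_eq_fval[OF assms])

text \<open>The epigraph of the maximum in the subproblem, without the quadratic term: the intersection over
  \<open>i\<close> of the epigraphs of \<open>g i\<close>, each sheared by an affine function of \<open>z\<close>.\<close>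

definition gap_epigraph ::
  "('m::finite \<Rightarrow> 'a::euclidean_space \<Rightarrow> real) \<Rightarrow> ('m \<Rightarrow> 'a \<Rightarrow> 'a) \<Rightarrow> ('m \<Rightarrow> 'a \<Rightarrow> ereal)
    \<Rightarrow> 'a \<Rightarrow> 'a \<Rightarrow> ('a \<times> real) set" where
  "gap_epigraph f df g x y =
     {(z, r). \<forall>i. g i z \<le> ereal (r - (df i y \<bullet> (z - y) + f i y - fval f g i x))}"

text \<open>Being a preimage under an affine map, each set inherits closedness and convexity from the
  epigraph of \<open>g i\<close>.\<close>

lemma gap_epigraph_eq:
  "gap_epigraph f df g x y =
     (\<Inter>i. (\<lambda>w. (fst w, snd w - (df i y \<bullet> (fst w - y) + f i y - fval f g i x)))
              -` ereal_epigraph (g i))"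
  by (auto simp: gap_epigraph_def ereal_epigraph_def)

lemma closed_gap_epigraph:
  assumes "\<And>i. closed_fun (g i)"
  shows "closed (gap_epigraph f df g x y)"
  unfolding gap_epigraph_eq
  by (intro closed_INT ballI closed_vimage continuous_intros)
    (use assms in \<open>auto simp: closed_fun_def\<close>)

lemma convex_gap_epigraph:
  assumes "\<And>i. convex_fun (g i)"
  shows "convex (gap_epigraph f df g x y)"
  unfolding gap_epigraph_eq
proof (intro convex_INT)
  fix i
  define T where "T w = (fst w, snd w - (df i y \<bullet> (fst w - y) + f i y - fval f g i x))" for w
  have "convex (T -` ereal_epigraph (g i))"
  proof (rule convexI)
    fix v w and p q :: real
    assume *: "v \<in> T -` ereal_epigraph (g i)" "w \<in> T -` ereal_epigraph (g i)"
      "0 \<le> p" "0 \<le> q" "p + q = 1"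
    have p: "p = 1 - q" using * by simp
    have "T (p *\<^sub>R v + q *\<^sub>R w) = p *\<^sub>R T v + q *\<^sub>R T w"
      unfolding p by (simp add: T_def inner_simps algebra_simps)
    moreover have "p *\<^sub>R T v + q *\<^sub>R T w \<in> ereal_epigraph (g i)"
      using assms[of i] * unfolding convex_fun_def by (intro convexD) auto
    ultimately show "p *\<^sub>R v + q *\<^sub>R w \<in> T -` ereal_epigraph (g i)"
      by simp
  qed
  then show "convex ((\<lambda>w. (fst w, snd w - (df i y \<bullet> (fst w - y) + f i y - fval f g i x)))
      -` ereal_epigraph (g i))"
    unfolding T_def .
qed

lemma gap_le_iff:
  assumes "\<And>i. proper_fun (g i)" "x \<in> domain (objective f g)"
  shows "(MAX i. ereal (df i y \<bullet> (z - y)) + g i z + ereal (f i y) - objective f g x i) \<le> ereal r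
    \<longleftrightarrow> (z, r) \<in> gap_epigraph f df g x y"
proof -
  have "ereal u + G + ereal v - ereal w \<le> ereal r \<longleftrightarrow> G \<le> ereal (r - (u + v - w))" for u v w G
    by (cases G) auto
  then show ?thesis
    by (simp add: gap_epigraph_def objective_eq_fval[OF assms])
qed

lemma gap_not_MInf:
  fixes g :: "'m::finite \<Rightarrow> 'a::euclidean_space \<Rightarrow> ereal"
  assumes "\<And>i. proper_fun (g i)" "x \<in> domain (objective f g)"
  shows "(MAX i. ereal (df i y \<bullet> (z - y)) + g i z + ereal (f i y) - objective f g x i) \<noteq> -\<infinity>"
    (is "Max (range ?h) \<noteq> _")
proof -
  obtain i where "Max (range ?h) = ?h i"
    using Max_range_attained[of ?h] by blast
  moreover have "?h i \<noteq> -\<infinity>"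
    using assms(1)[of i] unfolding objective_eq_fval[OF assms] proper_fun_def
    by (cases "g i z") auto
  ultimately show ?thesis
    by simp
qed

text \<open>Connects the description operator in \<open>prox_step\<close> with the epigraph minimiser: a minimiser exists
  by coercivity, and it is the only one because \<open>prox_min_three_point\<close> bounds the squared distance of any other
  one from it by zero.\<close>

lemma prox_step_minimizes:
  fixes f :: "'m::finite \<Rightarrow> 'a::euclidean_space \<Rightarrow> real"
  assumes g: "\<And>i. closed_fun (g i)" "\<And>i. proper_fun (g i)" "\<And>i. convex_fun (g i)"
    and x: "x \<in> domain (objective f g)" and l: "0 < l"
    and p: "p = prox_step f df g l x y"
  shows "\<exists>s. (p, s) \<in> gap_epigraph f df g x y \<and> (\<forall>z r. (z, r) \<in> gap_epigraph f df g x y \<longrightarrow>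
    s + l / 2 * (norm (p - y))\<^sup>2 \<le> r + l / 2 * (norm (z - y))\<^sup>2)"
proof -
  let ?E = "gap_epigraph f df g x y"
  let ?G = "\<lambda>z. MAX i. ereal (df i y \<bullet> (z - y)) + g i z + ereal (f i y) - objective f g x i"
  let ?c = "\<lambda>i. df i y \<bullet> (x - y) + f i y - f i x"
  \<comment> \<open>the value of the linearised maximum at \<open>x\<close>: there \<open>g i x\<close> cancels against the same term of \<open>F\<close>\<close>
  define r0 where "r0 = (MAX i. ?c i)"
  have r0_ge: "?c i \<le> r0" for i
    by (simp add: r0_def)
  obtain j where j: "r0 = ?c j"
    unfolding r0_def by (rule Max_range_attained)
  have "(x, r0) \<in> ?E"
    unfolding gap_epigraph_def using r0_ge by (auto simp: g_eq_fval[OF g(2) x] algebra_simps)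
  moreover have "(x, r0 - 1) \<notin> ?E"
    unfolding gap_epigraph_def
    by (auto simp: g_eq_fval[OF g(2) x] j algebra_simps intro!: exI[of _ j])
  ultimately have "\<exists>q s. (q, s) \<in> ?E \<and> (\<forall>z r. (z, r) \<in> ?E \<longrightarrow>
      s + l / 2 * (norm (q - y))\<^sup>2 \<le> r + l / 2 * (norm (z - y))\<^sup>2)"
    by (intro prox_min_exists closed_gap_epigraph convex_gap_epigraph g l)
  then obtain q s where q: "(q, s) \<in> ?E"
    and min: "\<And>z r. (z, r) \<in> ?E \<Longrightarrow>
      s + l / 2 * (norm (q - y))\<^sup>2 \<le> r + l / 2 * (norm (z - y))\<^sup>2"
    by blast
  have sub: "subproblem f df g l x y z = ?G z + ereal (l / 2 * (norm (z - y))\<^sup>2)" for z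
    by (simp add: subproblem_def)
  have G_cases: "?G z = \<infinity> \<or> (\<exists>r. ?G z = ereal r \<and> (z, r) \<in> ?E)" for z
    using gap_not_MInf[OF g(2) x, of df y z] gap_le_iff[OF g(2) x, of df y z]
    by (cases "?G z") auto
  have q_le: "subproblem f df g l x y q \<le> ereal (s + l / 2 * (norm (q - y))\<^sup>2)"
  proof -
    have "?G q \<le> ereal s"
      using gap_le_iff[OF g(2) x] q by blast
    then show ?thesis
      unfolding sub plus_ereal.simps(1)[symmetric] by (rule add_right_mono)
  qed
  have "is_arg_min (subproblem f df g l x y) (\<lambda>_. True) q"
  proof -
    have "subproblem f df g l x y q \<le> subproblem f df g l x y z" for z
      using G_cases[of z]
    proof
      assume "\<exists>r. ?G z = ereal r \<and> (z, r) \<in> ?E"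
      then obtain r where r: "?G z = ereal r" "(z, r) \<in> ?E" by blast
      have "ereal (s + l / 2 * (norm (q - y))\<^sup>2) \<le> subproblem f df g l x y z"
        unfolding sub r(1) using min[OF r(2)] by simp
      then show ?thesis
        using q_le by (rule order_trans[rotated])
    qed (simp add: sub)
    then show ?thesis
      by (simp add: is_arg_min_def not_less)
  qed
  moreover have "z = q" if "is_arg_min (subproblem f df g l x y) (\<lambda>_. True) z" for z
  proof -
    have le: "subproblem f df g l x y z \<le> ereal (s + l / 2 * (norm (q - y))\<^sup>2)"
      using that q_le unfolding is_arg_min_def not_less by (meson order_trans not_less)
    then have "?G z \<noteq> \<infinity>"
      by (auto simp: sub)
    then obtain r where r: "?G z = ereal r" "(z, r) \<in> ?E"
      using G_cases by blast
    have "s + l / 2 * (norm (q - y))\<^sup>2 + l / 2 * (norm (z - q))\<^sup>2 \<le> r + l / 2 * (norm (z - y))\<^sup>2"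
      by (rule prox_min_three_point[OF convex_gap_epigraph[OF g(3)] q r(2) min])
    then have "l / 2 * (norm (z - q))\<^sup>2 \<le> 0"
      using le unfolding sub r(1) by simp
    then show ?thesis
      using l by (simp add: mult_le_0_iff)
  qed
  ultimately have "p = q"
    unfolding p prox_step_def by (rule the_equality)
  then show ?thesis
    using q min by blast
qed

text \<open>The model used by the subproblem lies below the true increment \<open>F(z) - F(x)\<close> at every \<open>z\<close>, since
  \<open>f i\<close> is convex, and at \<open>p\<close> it falls short of it by at most \<open>l / 2 * (norm (p - y))\<^sup>2\<close>, by the descent
  lemma. Substituting both into the three-point inequality eliminates the model.\<close>

lemma prox_step_descent:
  fixes f :: "'m::finite \<Rightarrow> 'a::euclidean_space \<Rightarrow> real"
  assumes f: "\<And>i. convex_on UNIV (f i)" "\<And>i z. GDERIV (f i) z :> df i z"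
      "\<And>i. (L i)-lipschitz_on UNIV (df i)"
    and g: "\<And>i. closed_fun (g i)" "\<And>i. proper_fun (g i)" "\<And>i. convex_fun (g i)"
    and l: "\<And>i. L i \<le> l" "0 < l"
    and x: "x \<in> domain (objective f g)"
    and p_eq: "p = prox_step f df g l x y"
  shows "p \<in> domain (objective f g)" (is ?dom)
    and "z \<in> domain (objective f g) \<Longrightarrow> (\<And>i. fval f g i z - fval f g i x \<le> r) \<Longrightarrow>
      fval f g i p - fval f g i x + l / 2 * (norm (z - p))\<^sup>2 \<le> r + l / 2 * (norm (z - y))\<^sup>2"
proof -
  obtain s where s: "(p, s) \<in> gap_epigraph f df g x y"
    and min: "\<And>z r. (z, r) \<in> gap_epigraph f df g x y \<Longrightarrow>
      s + l / 2 * (norm (p - y))\<^sup>2 \<le> r + l / 2 * (norm (z - y))\<^sup>2"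
    using prox_step_minimizes[OF g x l(2) p_eq] by blast
  have gp: "g j p \<le> ereal (s - (df j y \<bullet> (p - y) + f j y - fval f g j x))" for j
    using s by (simp add: gap_epigraph_def)
  have "g j p < \<infinity>" for j
    by (rule le_less_trans[OF gp]) simp
  then show p: ?dom
    by (simp add: domain_objective_iff)
  assume z: "z \<in> domain (objective f g)" and r: "\<And>i. fval f g i z - fval f g i x \<le> r"
  have "fval f g j z - f j z \<le> r - (df j y \<bullet> (z - y) + f j y - fval f g j x)" for j
    using convex_gradient_below[OF f(1) f(2), of j y z] r[of j] by linarith
  then have "(z, r) \<in> gap_epigraph f df g x y"
    by (simp add: gap_epigraph_def g_eq_fval[OF g(2) z])
  then have "s + l / 2 * (norm (p - y))\<^sup>2 + l / 2 * (norm (z - p))\<^sup>2 \<le> r + l / 2 * (norm (z - y))\<^sup>2"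
    by (rule prox_min_three_point[OF convex_gap_epigraph[OF g(3)] s _ min])
  moreover have "f i p \<le> f i y + df i y \<bullet> (p - y) + L i / 2 * (norm (p - y))\<^sup>2"
    by (rule lipschitz_gradient_above[OF f(2) f(3)])
  moreover have "L i / 2 * (norm (p - y))\<^sup>2 \<le> l / 2 * (norm (p - y))\<^sup>2"
    using l(1) by (intro mult_right_mono) auto
  moreover have "fval f g i p - f i p \<le> s - (df i y \<bullet> (p - y) + f i y - fval f g i x)"
    using gp[of i] by (simp add: g_eq_fval[OF g(2) p])
  ultimately show "fval f g i p - fval f g i x + l / 2 * (norm (z - p))\<^sup>2
      \<le> r + l / 2 * (norm (z - y))\<^sup>2"
    by linarith
qed

text \<open>Lower semicontinuity of the objectives, in the form in which limits of the iterates need it.\<close>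

lemma closed_sublevel:
  assumes f: "\<And>i z. GDERIV (f i) z :> df i z"
    and g: "\<And>i. closed_fun (g i)" "\<And>i. proper_fun (g i)"
  shows "closed {z \<in> domain (objective f g). \<forall>i. fval f g i z \<le> c i}"
proof -
  have "continuous_on UNIV (f i)" for i
    using has_derivative_continuous[OF f[unfolded gderiv_def]]
    by (intro continuous_at_imp_continuous_on) blast
  then have "closed ((\<lambda>z. (z, c i - f i z)) -` ereal_epigraph (g i))" for i
    using g(1)[of i] unfolding closed_fun_def by (intro closed_vimage continuous_intros)
  moreover have "{z \<in> domain (objective f g). \<forall>i. fval f g i z \<le> c i}
      = (\<Inter>i. (\<lambda>z. (z, c i - f i z)) -` ereal_epigraph (g i))" (is "?A = ?B")
  proof
    show "?A \<subseteq> ?B"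
      using g_eq_fval[OF g(2)] by (fastforce simp: ereal_epigraph_def)
    show "?B \<subseteq> ?A"
    proof
      fix z assume "z \<in> ?B"
      then have le: "g i z \<le> ereal (c i - f i z)" for i
        by (auto simp: ereal_epigraph_def)
      have "g i z < \<infinity>" for i
        by (rule le_less_trans[OF le]) simp
      then have z: "z \<in> domain (objective f g)"
        by (simp add: domain_objective_iff)
      then show "z \<in> ?A"
        using le by (simp add: g_eq_fval[OF g(2) z])
    qed
  qed
  ultimately show ?thesis
    by auto
qed

section \<open>Growth of the momentum parameters\<close>

locale momentum =
  fixes a b :: real and t :: "nat \<Rightarrow> real"
  assumes a_pos: "0 < a" and a_less: "a < 1" and b_ge: "a\<^sup>2 / 4 \<le> b" and b_le: "b \<le> 1 / 4"
    and t_1: "t 1 = 1"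
    and t_Suc: "\<And>k. 1 \<le> k \<Longrightarrow> t (Suc k) = sqrt ((t k)\<^sup>2 - a * t k + b) + 1 / 2"
begin

text \<open>The recursion for \<open>t\<close> amounts to \<open>t\<^sub>k\<^sub>+\<^sub>1\<^sup>2 - t\<^sub>k\<^sub>+\<^sub>1 = t\<^sub>k\<^sup>2 - c\<^sub>k\<close>; with \<open>a = 0\<close> and \<open>b = 1 / 4\<close> the loss \<open>c\<^sub>k\<close>
  vanishes and the classical momentum is recovered.\<close>

definition c :: "nat \<Rightarrow> real" where "c k = a * t k + 1 / 4 - b"

definition s :: "nat \<Rightarrow> real" where "s k = (\<Sum>p = 1..<k. c p)"

definition \<gamma> :: "nat \<Rightarrow> real" where "\<gamma> k = (t k - 1) / t (Suc k)"

lemma radicand: "(t k)\<^sup>2 - a * t k + b = (t k - a / 2)\<^sup>2 + (b - a\<^sup>2 / 4)"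
  by (simp add: power2_eq_square algebra_simps)

lemma t_step_ge:
  assumes "1 \<le> k"
  shows "t k + (1 - a) / 2 \<le> t (Suc k)"
proof -
  have "t k - a / 2 \<le> sqrt ((t k)\<^sup>2 - a * t k + b)"
    by (rule real_le_rsqrt) (use radicand[of k] b_ge in simp)
  then show ?thesis
    using t_Suc[OF assms] by (simp add: field_simps)
qed

lemma t_step_gt: "1 \<le> k \<Longrightarrow> t k < t (Suc k)"
  using t_step_ge[of k] a_less by (simp add: field_simps)

lemma t_ge_linear:
  assumes "1 \<le> k"
  shows "1 + (1 - a) / 2 * (real k - 1) \<le> t k"
  using assms
proof (induction rule: nat_induct_at_least)
  case (Suc k)
  then show ?case
    using t_step_ge[of k] by (simp add: field_simps)
qed (use t_1 in simp)

lemma t_ge_1: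
  assumes "1 \<le> k"
  shows "1 \<le> t k"
proof -
  have "0 \<le> (1 - a) / 2 * (real k - 1)"
    using assms a_less by simp
  then show ?thesis
    using t_ge_linear[OF assms] by linarith
qed

lemma t_step_le:
  assumes "1 \<le> k"
  shows "t (Suc k) \<le> t k + 1"
proof -
  have at: "0 \<le> a * t k"
    using a_pos t_ge_1[OF assms] by simp
  have "sqrt ((t k)\<^sup>2 - a * t k + b) \<le> t k + 1 / 2"
    using t_ge_1[OF assms] at b_le
    by (intro real_le_lsqrt) (auto simp: power2_eq_square algebra_simps)
  then show ?thesis
    using t_Suc[OF assms] by simp
qed

lemma t_square:
  assumes "1 \<le> k"
  shows "(t (Suc k))\<^sup>2 - t (Suc k) = (t k)\<^sup>2 - c k"
proof -
  have "(t (Suc k) - 1 / 2)\<^sup>2 = (t k)\<^sup>2 - a * t k + b"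
    using t_Suc[OF assms] radicand[of k] b_ge by simp
  then show ?thesis
    by (simp add: c_def power2_eq_square algebra_simps)
qed

lemma b_nonneg: "0 \<le> b"
  by (rule order_trans[OF _ b_ge]) simp

lemma c_ge: "a * t k \<le> c k"
  using b_le by (simp add: c_def)

lemma c_le: "c k \<le> a * t k + 1 / 4"
  using b_nonneg by (simp add: c_def)

lemma c_nonneg: "1 \<le> k \<Longrightarrow> 0 \<le> c k"
  using a_pos t_ge_1[of k] by (intro order_trans[OF _ c_ge]) simp

lemma s_1 [simp]: "s (Suc 0) = 0"
  by (simp add: s_def)

lemma s_Suc: "1 \<le> k \<Longrightarrow> s (Suc k) = s k + c k"
  by (simp add: s_def)

lemma s_nonneg: "0 \<le> s k"
  unfolding s_def by (intro sum_nonneg c_nonneg) auto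

lemma filterlim_t: "filterlim t at_top sequentially"
proof -
  have "filterlim (\<lambda>k. (1 - (1 - a) / 2) + (1 - a) / 2 * real k) at_top sequentially"
    using a_less
    by (intro filterlim_tendsto_add_at_top[OF tendsto_const]
        filterlim_tendsto_pos_mult_at_top[OF tendsto_const] filterlim_real_sequentially) simp
  moreover have "(1 - (1 - a) / 2) + (1 - a) / 2 * real k \<le> t k" if "1 \<le> k" for k
    using t_ge_linear[OF that] by (simp only: right_diff_distrib)
  then have "\<forall>\<^sub>F k in sequentially. (1 - (1 - a) / 2) + (1 - a) / 2 * real k \<le> t k"
    by (rule eventually_sequentiallyI)
  ultimately show ?thesis
    by (rule filterlim_at_top_mono)
qed

lemma \<gamma>_nonneg: "1 \<le> k \<Longrightarrow> 0 \<le> \<gamma> k"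
  using t_ge_1[of k] t_ge_1[of "Suc k"] by (simp add: \<gamma>_def)

lemma \<gamma>_le:
  assumes "1 \<le> k"
  shows "\<gamma> k \<le> 1 - 1 / t k"
proof -
  have "\<gamma> k \<le> (t k - 1) / t k"
    unfolding \<gamma>_def using t_ge_1[OF assms] t_step_gt[OF assms]
    by (intro divide_left_mono) auto
  then show ?thesis
    using t_ge_1[OF assms] by (simp add: diff_divide_distrib)
qed

lemma \<gamma>_le_1: "1 \<le> k \<Longrightarrow> \<gamma> k \<le> 1"
  using t_ge_1[of k] by (intro order_trans[OF \<gamma>_le]) auto

lemma \<gamma>_sq_le: "1 \<le> k \<Longrightarrow> (\<gamma> k)\<^sup>2 \<le> \<gamma> k"
  using \<gamma>_nonneg[of k] \<gamma>_le_1[of k] by (simp add: power2_eq_square mult_left_le)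

lemma t_\<gamma>: "1 \<le> k \<Longrightarrow> t (Suc k) * \<gamma> k = t k - 1"
  using t_ge_1[of "Suc k"] by (simp add: \<gamma>_def)

text \<open>In each step \<open>s\<close> grows by at least \<open>a * t\<close> and \<open>t\<^sup>2\<close> by at most \<open>(1 - a) * t + 1\<close>, so \<open>s\<close> dominates \<open>a / (1 - a) * t\<^sup>2\<close> up to an error of order \<open>k\<close>, that is of order \<open>t\<close>.\<close>

lemma s_ge_quadratic:
  assumes "1 \<le> k"
  shows "a / (1 - a) * (t k)\<^sup>2 - a / (1 - a) * (1 + 2 / (1 - a)) * t k \<le> s k"
proof -
  define \<kappa> where "\<kappa> = a / (1 - a)"
  have \<kappa>: "0 < \<kappa>" "\<kappa> * (1 - a) = a"
    using a_pos a_less by (auto simp: \<kappa>_def)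
  have "\<kappa> * (t k)\<^sup>2 - \<kappa> * real k \<le> s k"
    using assms
  proof (induction rule: nat_induct_at_least)
    case (Suc k)
    have "(t (Suc k))\<^sup>2 \<le> (t k)\<^sup>2 + (1 - a) * t k + 1"
      using t_square[of k] t_step_le[of k] c_ge[of k] Suc.hyps by (simp add: algebra_simps)
    then have "\<kappa> * (t (Suc k))\<^sup>2 \<le> \<kappa> * ((t k)\<^sup>2 + (1 - a) * t k + 1)"
      using \<kappa> by (intro mult_left_mono) auto
    also have "\<dots> = \<kappa> * (t k)\<^sup>2 + \<kappa> * (1 - a) * t k + \<kappa>"
      by (simp add: algebra_simps)
    finally have "\<kappa> * (t (Suc k))\<^sup>2 \<le> \<kappa> * (t k)\<^sup>2 + a * t k + \<kappa>"
      by (simp add: \<kappa>(2))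
    then show ?case
      using Suc.IH c_ge[of k] s_Suc[OF Suc.hyps] by (simp add: algebra_simps)
  qed (use t_1 in simp)
  moreover have "real k \<le> (1 + 2 / (1 - a)) * t k"
  proof -
    have "real k - 1 \<le> 2 / (1 - a) * (t k - 1)"
      using t_ge_linear[OF assms] a_less by (simp add: field_simps)
    moreover have "0 \<le> 2 / (1 - a)"
      using a_less by simp
    ultimately have "real k \<le> 1 + 2 / (1 - a) * t k"
      by (simp only: right_diff_distrib)
    then show ?thesis
      using t_ge_1[OF assms] by (simp add: distrib_right)
  qed
  then have "\<kappa> * real k \<le> \<kappa> * (1 + 2 / (1 - a)) * t k"
    using \<kappa> by (simp add: mult.assoc)
  ultimately show ?thesis
    by (simp add: \<kappa>_def)
qed

text \<open>The net coefficient with which \<open>(norm (x k - x (k - 1)))\<^sup>2\<close> leaves the energy \<open>G\<close> below. Since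
  \<open>\<gamma>\<^sup>2 \<le> 1 - 1 / t\<close>, it is at least \<open>s / t - c\<close>, and \<open>s / t\<close> is about \<open>a / (1 - a) * t\<close> whereas \<open>c\<close> is about
  \<open>a * t\<close>. The difference is positive exactly because \<open>a > 0\<close>; it may be negative for small \<open>k\<close>.\<close>

lemma dissipation_ge:
  "\<exists>\<kappa>>0. \<exists>N. \<forall>k\<ge>N. \<kappa> * t k \<le> s k - s (Suc k) * (\<gamma> k)\<^sup>2"
proof -
  define \<kappa> where "\<kappa> = a / (1 - a) - a"
  define C where "C = a / (1 - a) * (1 + 2 / (1 - a)) + 1 / 4"
  have "\<kappa> = a * a / (1 - a)"
    using a_less by (simp add: \<kappa>_def field_simps)
  then have \<kappa>: "0 < \<kappa>"
    using a_pos a_less by simp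
  have main: "\<kappa> * t k - C \<le> s k - s (Suc k) * (\<gamma> k)\<^sup>2" if k: "1 \<le> k" for k
  proof -
    have t: "1 \<le> t k" using t_ge_1[OF k] .
    have sc: "0 \<le> s k + c k"
      using s_nonneg[of k] c_nonneg[OF k] by simp
    have "(\<gamma> k)\<^sup>2 \<le> 1 - 1 / t k"
      using \<gamma>_sq_le[OF k] \<gamma>_le[OF k] by simp
    then have "s (Suc k) * (\<gamma> k)\<^sup>2 \<le> (s k + c k) * (1 - 1 / t k)"
      unfolding s_Suc[OF k] using sc by (rule mult_left_mono)
    also have "\<dots> = s k + c k - s k / t k - c k / t k"
      by (simp add: algebra_simps add_divide_distrib)
    also have "\<dots> \<le> s k + c k - s k / t k"
      using c_nonneg[OF k] t by simp
    finally have 1: "s (Suc k) * (\<gamma> k)\<^sup>2 \<le> s k + c k - s k / t k" .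
    have "(a / (1 - a) * (t k)\<^sup>2 - a / (1 - a) * (1 + 2 / (1 - a)) * t k) / t k \<le> s k / t k"
      using s_ge_quadratic[OF k] t by (intro divide_right_mono) auto
    then have "a / (1 - a) * t k - a / (1 - a) * (1 + 2 / (1 - a)) \<le> s k / t k"
      using t by (simp add: power2_eq_square diff_divide_distrib)
    then show ?thesis
      using 1 c_le[of k] by (simp add: \<kappa>_def C_def algebra_simps)
  qed
  have "\<forall>\<^sub>F k in sequentially. 2 * C / \<kappa> \<le> t k"
    using filterlim_t by (simp add: filterlim_at_top)
  then have "\<forall>\<^sub>F k in sequentially. 2 * C / \<kappa> \<le> t k \<and> 1 \<le> k"
    using eventually_ge_at_top[of "1::nat"] by eventually_elim simp
  then obtain N where N: "\<And>k. N \<le> k \<Longrightarrow> 2 * C / \<kappa> \<le> t k \<and> 1 \<le> k"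
    unfolding eventually_at_top_linorder by blast
  have "\<kappa> / 2 * t k \<le> s k - s (Suc k) * (\<gamma> k)\<^sup>2" if "N \<le> k" for k
  proof -
    have "C \<le> \<kappa> / 2 * t k"
      using N[OF that] \<kappa> by (simp add: field_simps)
    then show ?thesis
      using main[of k] N[OF that] by (simp add: field_simps)
  qed
  then show ?thesis
    using \<kappa> by (intro exI[of _ "\<kappa> / 2"]) auto
qed

text \<open>The positive part \<open>\<theta>\<close> of the increments of \<open>h\<close> satisfies
  \<open>t\<^sub>k\<^sub>+\<^sub>1 \<theta>\<^sub>k\<^sub>+\<^sub>1 + \<theta>\<^sub>k \<le> t\<^sub>k \<theta>\<^sub>k + t\<^sub>k\<^sub>+\<^sub>1 \<delta>\<^sub>k\<close>, because \<open>t\<^sub>k\<^sub>+\<^sub>1 \<gamma>\<^sub>k = t\<^sub>k - 1\<close>. Telescoping makes \<open>\<theta>\<close> summable, and a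
  nonnegative sequence with summable positive increments converges.\<close>

lemma inertial_inequality_convergent:
  fixes h \<delta> :: "nat \<Rightarrow> real"
  assumes h: "\<And>k. 0 \<le> h k" and \<delta>: "\<And>k. 0 \<le> \<delta> k"
    and step: "\<And>k. 1 \<le> k \<Longrightarrow> h (Suc k) - h k \<le> \<gamma> k * (h k - h (k - 1)) + \<delta> k"
    and sum: "\<And>n. (\<Sum>k = 1..<n. t (Suc k) * \<delta> k) \<le> C"
  shows "convergent h"
proof -
  define \<theta> where "\<theta> k = max 0 (h k - h (k - 1))" for k
  have \<theta>_nonneg: "0 \<le> \<theta> k" for k
    by (simp add: \<theta>_def)
  have \<theta>_step: "t (Suc k) * \<theta> (Suc k) \<le> (t k - 1) * \<theta> k + t (Suc k) * \<delta> k" if k: "1 \<le> k" for k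
  proof -
    have t: "1 \<le> t k" "1 \<le> t (Suc k)" using t_ge_1[of k] t_ge_1[of "Suc k"] k by auto
    have "\<gamma> k * (h k - h (k - 1)) \<le> \<gamma> k * \<theta> k"
      using \<gamma>_nonneg[OF k] by (intro mult_left_mono) (auto simp: \<theta>_def)
    then have "\<theta> (Suc k) \<le> \<gamma> k * \<theta> k + \<delta> k"
      using step[OF k] \<delta>[of k] \<gamma>_nonneg[OF k] \<theta>_nonneg[of k]
      by (simp add: \<theta>_def[of "Suc k"])
    then have "t (Suc k) * \<theta> (Suc k) \<le> t (Suc k) * (\<gamma> k * \<theta> k + \<delta> k)"
      using t by (intro mult_left_mono) auto
    also have "\<dots> = (t (Suc k) * \<gamma> k) * \<theta> k + t (Suc k) * \<delta> k"
      by (simp add: algebra_simps)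
    finally show ?thesis
      by (simp add: t_\<gamma>[OF k])
  qed
  have \<theta>_sum: "t n * \<theta> n + (\<Sum>k = 1..<n. \<theta> k) \<le> \<theta> 1 + (\<Sum>k = 1..<n. t (Suc k) * \<delta> k)"
    if "1 \<le> n" for n
    using that
  proof (induction rule: nat_induct_at_least)
    case (Suc n)
    then show ?case
      using \<theta>_step[of n] by (simp add: algebra_simps)
  qed (use t_1 in simp)
  have "(\<Sum>i<n. \<theta> (Suc i)) \<le> \<theta> 1 + C" for n
  proof -
    have "(\<Sum>i<n. \<theta> (Suc i)) = (\<Sum>k = 1..<Suc n. \<theta> k)"
      by (simp add: sum.atLeast1_atMost_eq atLeastLessThanSuc_atLeastAtMost
          del: sum.op_ivl_Suc)
    moreover have "0 \<le> t (Suc n) * \<theta> (Suc n)"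
      using t_ge_1[of "Suc n"] \<theta>_nonneg by simp
    ultimately show ?thesis
      using \<theta>_sum[of "Suc n"] sum[of "Suc n"] by simp
  qed
  then have "summable (\<lambda>i. \<theta> (Suc i))"
    using \<theta>_nonneg by (intro summableI_nonneg_bounded)
  then have conv: "convergent (\<lambda>n. \<Sum>i<n. \<theta> (Suc i))" and
    le: "\<And>n. (\<Sum>i<n. \<theta> (Suc i)) \<le> (\<Sum>i. \<theta> (Suc i))"
    using \<theta>_nonneg by (auto simp: summable_iff_convergent intro!: sum_le_suminf)
  let ?d = "\<lambda>n. h n - (\<Sum>i<n. \<theta> (Suc i))"
  have dec: "decseq ?d"
    by (rule decseq_SucI) (simp add: \<theta>_def)
  have lower: "- (\<Sum>i. \<theta> (Suc i)) \<le> ?d n" for n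
    using h[of n] le[of n] by simp
  obtain L where "?d \<longlonglongrightarrow> L"
    by (rule decseq_convergent[OF dec, of "- (\<Sum>i. \<theta> (Suc i))"]) (use lower in auto)
  then have "convergent ?d"
    by (rule convergentI)
  from convergent_add[OF this conv] show ?thesis
    by simp
qed

end

section \<open>Energy and convergence of the accelerated iteration\<close>

text \<open>The identity behind both the energy estimate and the expansion of the distance from the
  extrapolated point \<open>y\<close>.\<close>

lemma norm_affine_square:
  fixes p q :: "'a::real_inner"
  shows "(norm (t *\<^sub>R p - (t - 1) *\<^sub>R q))\<^sup>2
    = t * (norm p)\<^sup>2 - (t - 1) * (norm q)\<^sup>2 + t * (t - 1) * (norm (p - q))\<^sup>2"
  by (simp only: power2_norm_eq_inner)
    (simp add: inner_diff_left inner_diff_right inner_commute power2_eq_square algebra_simps)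

text \<open>All that the convergence proof uses of the algorithm. The two inequalities \<open>descent\<close> and
  \<open>comparison\<close> compare the new iterate with the previous one in every objective, and with an arbitrary
  point of the domain in at least one objective.\<close>

locale accelerated_descent = momentum +
  fixes F :: "'m::finite \<Rightarrow> 'a::euclidean_space \<Rightarrow> real" and D :: "'a set" and l :: real
    and x y :: "nat \<Rightarrow> 'a"
  assumes l_pos: "0 < l"
    and x_in: "\<And>k. x k \<in> D"
    and y_1: "y 1 = x 0"
    and y_Suc: "\<And>k. 1 \<le> k \<Longrightarrow> y (Suc k) = x k + \<gamma> k *\<^sub>R (x k - x (k - 1))"
    and descent: "\<And>k i. F i (x (Suc k)) - F i (x k)
      \<le> l / 2 * ((norm (x k - y (Suc k)))\<^sup>2 - (norm (x k - x (Suc k)))\<^sup>2)"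
    and comparison: "\<And>k z. z \<in> D \<Longrightarrow> \<exists>i. F i (x (Suc k)) - F i z
      \<le> l / 2 * ((norm (z - y (Suc k)))\<^sup>2 - (norm (z - x (Suc k)))\<^sup>2)"
    and sublevel_closed: "\<And>c. closed {z \<in> D. \<forall>i. F i z \<le> c i}"
    and dominating: "\<exists>R. \<forall>w\<in>D. (\<forall>i. F i w \<le> F i (x 0)) \<longrightarrow>
      (\<exists>z\<in>D. (\<forall>i. F i z \<le> F i w) \<and> (norm (z - x 0))\<^sup>2 \<le> R)"
begin

definition \<Delta> :: "nat \<Rightarrow> real" where "\<Delta> k = (norm (x k - x (k - 1)))\<^sup>2"

text \<open>\<open>\<sigma> k z\<close> plays the role of \<open>F(x\<^sup>k) - F(z)\<close> in the scalar case; its supremum over \<open>z\<close> is a merit function for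
  weak Pareto optimality.\<close>

definition \<sigma> :: "nat \<Rightarrow> 'a \<Rightarrow> real" where "\<sigma> k z = (MIN i. F i (x k) - F i z)"

definition u :: "nat \<Rightarrow> 'a" where "u k = t k *\<^sub>R x k - (t k - 1) *\<^sub>R x (k - 1)"

text \<open>The usual energy \<open>t\<^sub>k\<^sup>2 \<sigma>\<^sub>k + l / 2 * (norm (u\<^sub>k - z))\<^sup>2\<close> decreases up to the term \<open>- c\<^sub>k \<sigma>\<^sub>k\<close>, whose sign is
  unknown for a general \<open>z\<close>. Adding \<open>s\<^sub>k\<close> times the inertial energy \<open>\<sigma>\<^sub>k + l / 2 * \<Delta>\<^sub>k\<close> cancels that term,
  since \<open>s\<^sub>k\<^sub>+\<^sub>1 = s\<^sub>k + c\<^sub>k\<close>.\<close>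

definition G :: "nat \<Rightarrow> 'a \<Rightarrow> real" where
  "G k z = ((t k)\<^sup>2 + s k) * \<sigma> k z + l / 2 * (norm (u k - z))\<^sup>2 + l / 2 * s k * \<Delta> k"

lemma \<Delta>_nonneg: "0 \<le> \<Delta> k"
  by (simp add: \<Delta>_def)

lemma extrapolation: "1 \<le> k \<Longrightarrow> (norm (x k - y (Suc k)))\<^sup>2 = (\<gamma> k)\<^sup>2 * \<Delta> k"
  by (simp add: y_Suc \<Delta>_def power_mult_distrib)

lemma descent_\<Delta>:
  assumes "1 \<le> k"
  shows "F i (x (Suc k)) + l / 2 * \<Delta> (Suc k) \<le> F i (x k) + l / 2 * ((\<gamma> k)\<^sup>2 * \<Delta> k)"
  using descent[of i k] extrapolation[OF assms]
  by (simp add: \<Delta>_def norm_minus_commute algebra_simps)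

text \<open>The objectives themselves need not decrease, but their sum with the kinetic term does, since
  \<open>\<gamma> \<le> 1\<close>.\<close>

lemma inertial_energy_Suc:
  assumes "1 \<le> k"
  shows "F i (x (Suc k)) + l / 2 * \<Delta> (Suc k) \<le> F i (x k) + l / 2 * \<Delta> k"
proof -
  have "(\<gamma> k)\<^sup>2 * \<Delta> k \<le> \<Delta> k"
    using \<gamma>_sq_le[OF assms] \<gamma>_le_1[OF assms] \<Delta>_nonneg[of k] by (intro mult_left_le_one_le) auto
  then have "l / 2 * ((\<gamma> k)\<^sup>2 * \<Delta> k) \<le> l / 2 * \<Delta> k"
    using l_pos by (intro mult_left_mono) auto
  then show ?thesis
    using descent_\<Delta>[OF assms, of i] by linarith
qed

lemma inertial_energy_antimono:
  assumes "1 \<le> k" "k \<le> n"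
  shows "F i (x n) + l / 2 * \<Delta> n \<le> F i (x k) + l / 2 * \<Delta> k"
  using assms(2)
proof (induction rule: dec_induct)
  case (step n)
  then show ?case
    using inertial_energy_Suc[of n i] assms(1) by linarith
qed simp

lemma F_le_start: "F i (x k) \<le> F i (x 0)"
proof (cases "k = 0")
  case False
  have "F i (x k) + l / 2 * \<Delta> k \<le> F i (x 1) + l / 2 * \<Delta> 1"
    using False by (intro inertial_energy_antimono) auto
  also have "\<dots> \<le> F i (x 0)"
    using descent[of i 0] y_1 by (simp add: \<Delta>_def norm_minus_commute)
  finally show ?thesis
    using l_pos \<Delta>_nonneg[of k] by (smt (verit) divide_pos_pos mult_nonneg_nonneg)
qed simp

lemma \<sigma>_le: "\<sigma> k z \<le> F i (x k) - F i z"
  unfolding \<sigma>_def by (rule Min_le) auto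

lemma \<sigma>_attained: "\<exists>i. \<sigma> k z = F i (x k) - F i z"
proof -
  have "\<sigma> k z \<in> range (\<lambda>i. F i (x k) - F i z)"
    unfolding \<sigma>_def by (rule Min_in) auto
  then show ?thesis
    by blast
qed

lemma \<sigma>_ge_iff: "r \<le> \<sigma> k z \<longleftrightarrow> (\<forall>i. r \<le> F i (x k) - F i z)"
  by (auto simp: \<sigma>_def)

lemma \<sigma>_descent:
  "\<sigma> (Suc k) z \<le> \<sigma> k z + l / 2 * ((norm (x k - y (Suc k)))\<^sup>2 - (norm (x k - x (Suc k)))\<^sup>2)"
proof -
  obtain i where "\<sigma> k z = F i (x k) - F i z"
    using \<sigma>_attained by blast
  then show ?thesis
    using \<sigma>_le[of "Suc k" z i] descent[of i k] by linarith
qed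

lemma \<sigma>_comparison:
  assumes "z \<in> D"
  shows "\<sigma> (Suc k) z \<le> l / 2 * ((norm (z - y (Suc k)))\<^sup>2 - (norm (z - x (Suc k)))\<^sup>2)"
  using comparison[OF assms, of k] \<sigma>_le[of "Suc k" z] order_trans by blast

lemma u_extrapolated:
  assumes "1 \<le> k"
  shows "t (Suc k) *\<^sub>R y (Suc k) - (t (Suc k) - 1) *\<^sub>R x k = u k"
proof -
  have "t (Suc k) *\<^sub>R y (Suc k) - (t (Suc k) - 1) *\<^sub>R x k
      = x k + (t (Suc k) * \<gamma> k) *\<^sub>R (x k - x (k - 1))"
    by (simp add: y_Suc[OF assms] algebra_simps)
  also have "\<dots> = u k"
    by (simp only: t_\<gamma>[OF assms]) (simp add: u_def algebra_simps)
  finally show ?thesis .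
qed

text \<open>The combination \<open>t (t - 1)\<close> times \<open>\<sigma>_descent\<close> plus \<open>t\<close> times \<open>\<sigma>_comparison\<close>, at \<open>t = t\<^sub>k\<^sub>+\<^sub>1\<close>: by
  \<open>norm_affine_square\<close> its right-hand side is the difference of two squares.\<close>

lemma fista_energy:
  assumes k: "1 \<le> k" and z: "z \<in> D"
  shows "(t (Suc k))\<^sup>2 * \<sigma> (Suc k) z + l / 2 * (norm (u (Suc k) - z))\<^sup>2
    \<le> ((t k)\<^sup>2 - c k) * \<sigma> k z + l / 2 * (norm (u k - z))\<^sup>2"
proof -
  define T where "T = t (Suc k)"
  define X Y P where "X = x k" "Y = y (Suc k)" "P = x (Suc k)"
  define A where "A = (norm (X - Y))\<^sup>2 - (norm (X - P))\<^sup>2"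
  define B where "B = (norm (z - Y))\<^sup>2 - (norm (z - P))\<^sup>2"
  have T: "1 \<le> T" using t_ge_1[of "Suc k"] by (simp add: T_def)
  have shifted: "(norm (T *\<^sub>R Q - (T - 1) *\<^sub>R X - z))\<^sup>2
      = T * (norm (z - Q))\<^sup>2 - (T - 1) * (norm (z - X))\<^sup>2 + T * (T - 1) * (norm (X - Q))\<^sup>2" for Q
    using norm_affine_square[of T "z - Q" "z - X"]
      norm_minus_commute[of "T *\<^sub>R Q - (T - 1) *\<^sub>R X" z]
    by (simp add: algebra_simps)
  have uk: "u k = T *\<^sub>R Y - (T - 1) *\<^sub>R X" and uk': "u (Suc k) = T *\<^sub>R P - (T - 1) *\<^sub>R X"
    using u_extrapolated[OF k] by (auto simp: T_def X_Y_P_def u_def)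
  have norms: "(norm (u k - z))\<^sup>2 - (norm (u (Suc k) - z))\<^sup>2 = T * (T - 1) * A + T * B"
    unfolding uk uk' shifted A_def B_def by (simp add: algebra_simps)
  have "T * (T - 1) * \<sigma> (Suc k) z \<le> T * (T - 1) * (\<sigma> k z + l / 2 * A)"
    using \<sigma>_descent[of k z] T unfolding A_def X_Y_P_def by (intro mult_left_mono) auto
  moreover have "T * \<sigma> (Suc k) z \<le> T * (l / 2 * B)"
    using \<sigma>_comparison[OF z, of k] T unfolding B_def X_Y_P_def by (intro mult_left_mono) auto
  moreover have "T * (T - 1) * (\<sigma> k z + l / 2 * A) + T * (l / 2 * B)
      = (T\<^sup>2 - T) * \<sigma> k z + l / 2 * (T * (T - 1) * A + T * B)"
    by (simp add: power2_eq_square field_simps)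
  moreover have "T * (T - 1) * \<sigma> (Suc k) z + T * \<sigma> (Suc k) z = T\<^sup>2 * \<sigma> (Suc k) z"
    by (simp add: power2_eq_square algebra_simps)
  ultimately have "T\<^sup>2 * \<sigma> (Suc k) z \<le> (T\<^sup>2 - T) * \<sigma> k z + l / 2 * (T * (T - 1) * A + T * B)"
    by linarith
  then show ?thesis
    unfolding norms[symmetric] using t_square[OF k] by (simp add: T_def algebra_simps)
qed

lemma G_Suc_le:
  assumes k: "1 \<le> k" and z: "z \<in> D"
  shows "G (Suc k) z \<le> G k z - l / 2 * ((s k - s (Suc k) * (\<gamma> k)\<^sup>2) * \<Delta> k)"
proof -
  have "\<sigma> (Suc k) z + l / 2 * \<Delta> (Suc k) \<le> \<sigma> k z + l / 2 * ((\<gamma> k)\<^sup>2 * \<Delta> k)"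
    using \<sigma>_descent[of k z] extrapolation[OF k]
    by (simp add: \<Delta>_def norm_minus_commute algebra_simps)
  then have "s (Suc k) * (\<sigma> (Suc k) z + l / 2 * \<Delta> (Suc k))
      \<le> s (Suc k) * (\<sigma> k z + l / 2 * ((\<gamma> k)\<^sup>2 * \<Delta> k))"
    by (intro mult_left_mono s_nonneg)
  moreover have "s (Suc k) * \<sigma> k z = s k * \<sigma> k z + c k * \<sigma> k z"
    using s_Suc[OF k] by (simp add: algebra_simps)
  ultimately show ?thesis
    using fista_energy[OF k z] by (simp add: G_def algebra_simps)
qed

lemma G_1_le:
  assumes "z \<in> D"
  shows "G 1 z \<le> l / 2 * (norm (x 0 - z))\<^sup>2"
proof -
  have "u 1 = x 1" by (simp add: u_def t_1[simplified])
  then show ?thesis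
    using \<sigma>_comparison[OF assms, of 0] t_1 y_1
    by (simp add: G_def norm_minus_commute algebra_simps)
qed

text \<open>Summing \<open>G_Suc_le\<close>. The finitely many steps at which the dissipation coefficient is too small
  are collected in the constant \<open>C\<close>, which depends on the iterates but not on \<open>z\<close>.\<close>

lemma energy_bound:
  "\<exists>\<kappa>>0. \<exists>C\<ge>0. \<forall>z\<in>D. \<forall>n\<ge>1.
     G n z + l / 2 * (\<kappa> * (\<Sum>k = 1..<n. t k * \<Delta> k)) \<le> l / 2 * ((norm (x 0 - z))\<^sup>2 + C)"
proof -
  obtain \<kappa> N where \<kappa>: "0 < \<kappa>" "\<And>k. N \<le> k \<Longrightarrow> \<kappa> * t k \<le> s k - s (Suc k) * (\<gamma> k)\<^sup>2"
    using dissipation_ge by blast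
  define e where "e k = max 0 (\<kappa> * t k - (s k - s (Suc k) * (\<gamma> k)\<^sup>2)) * \<Delta> k" for k
  define C where "C = (\<Sum>k = 1..<N. e k)"
  have e_nonneg: "0 \<le> e k" for k
    by (simp add: e_def \<Delta>_nonneg)
  have e_0: "e k = 0" if "N \<le> k" for k
    using \<kappa>(2)[OF that] by (simp add: e_def max_def)
  have e_sum: "(\<Sum>k = 1..<n. e k) \<le> C" for n
  proof -
    have "(\<Sum>k = 1..<n. e k) \<le> (\<Sum>k = 1..<max n N. e k)"
      by (intro sum_mono2 e_nonneg) auto
    also have "\<dots> = C"
      unfolding C_def by (intro sum.mono_neutral_right) (auto intro!: e_0)
    finally show ?thesis .
  qed
  have "G n z + l / 2 * (\<kappa> * (\<Sum>k = 1..<n. t k * \<Delta> k)) \<le> l / 2 * ((norm (x 0 - z))\<^sup>2 + C)"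
    if z: "z \<in> D" and n: "1 \<le> n" for z n
  proof -
    have "G n z + l / 2 * (\<kappa> * (\<Sum>k = 1..<n. t k * \<Delta> k)) \<le> G 1 z + l / 2 * (\<Sum>k = 1..<n. e k)"
      using n
    proof (induction rule: nat_induct_at_least)
      case (Suc n)
      have "(\<kappa> * t n - (s n - s (Suc n) * (\<gamma> n)\<^sup>2)) * \<Delta> n \<le> e n"
        unfolding e_def by (intro mult_right_mono \<Delta>_nonneg) auto
      then have "l / 2 * ((\<kappa> * t n - (s n - s (Suc n) * (\<gamma> n)\<^sup>2)) * \<Delta> n) \<le> l / 2 * e n"
        using l_pos by (intro mult_left_mono) auto
      then show ?case
        using Suc G_Suc_le[of n z] z by (simp add: algebra_simps)
    qed simp
    also have "l / 2 * (\<Sum>k = 1..<n. e k) \<le> l / 2 * C"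
      using l_pos e_sum[of n] by (intro mult_left_mono) auto
    then have "G 1 z + l / 2 * (\<Sum>k = 1..<n. e k) \<le> l / 2 * ((norm (x 0 - z))\<^sup>2 + C)"
      using G_1_le[OF z] by (simp add: algebra_simps)
    finally show ?thesis .
  qed
  moreover have "0 \<le> C"
    unfolding C_def by (intro sum_nonneg e_nonneg)
  ultimately show ?thesis
    using \<kappa>(1) by blast
qed

text \<open>For each \<open>n\<close> the energy bound is used with its own \<open>z\<close>, a point dominating \<open>x n\<close> within bounded
  distance of the start. Then \<open>\<sigma> n z \<ge> 0\<close> and all terms of the energy are nonnegative.\<close>

lemma momentum_sum_bounded:
  "\<exists>B. (\<forall>k\<ge>1. norm (u k - x 0) \<le> B) \<and> (\<forall>n\<ge>1. (\<Sum>k = 1..<n. t k * \<Delta> k) \<le> B)"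
proof -
  obtain \<kappa> C where \<kappa>: "0 < \<kappa>" and C: "0 \<le> C"
    and energy: "\<And>z n. z \<in> D \<Longrightarrow> 1 \<le> n \<Longrightarrow>
      G n z + l / 2 * (\<kappa> * (\<Sum>k = 1..<n. t k * \<Delta> k)) \<le> l / 2 * ((norm (x 0 - z))\<^sup>2 + C)"
    using energy_bound by blast
  obtain R where R: "\<And>w. w \<in> D \<Longrightarrow> (\<And>i. F i w \<le> F i (x 0)) \<Longrightarrow>
      \<exists>z\<in>D. (\<forall>i. F i z \<le> F i w) \<and> (norm (z - x 0))\<^sup>2 \<le> R"
    using dominating by blast
  have both: "norm (u n - x 0) \<le> sqrt (R + C) + sqrt R \<and> (\<Sum>k = 1..<n. t k * \<Delta> k) \<le> (R + C) / \<kappa>"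
    if n: "1 \<le> n" for n
  proof -
    define S where "S = (\<Sum>k = 1..<n. t k * \<Delta> k)"
    obtain z where z: "z \<in> D" "\<And>i. F i z \<le> F i (x n)" "(norm (z - x 0))\<^sup>2 \<le> R"
      using R[OF x_in F_le_start] by blast
    have S: "0 \<le> S"
      unfolding S_def
      by (intro sum_nonneg mult_nonneg_nonneg \<Delta>_nonneg order_trans[OF _ t_ge_1]) auto
    have "0 \<le> \<sigma> n z"
      using z(2) by (simp add: \<sigma>_ge_iff)
    then have "l / 2 * (norm (u n - z))\<^sup>2 \<le> G n z"
      using s_nonneg[of n] \<Delta>_nonneg[of n] l_pos by (simp add: G_def)
    then have "l / 2 * (norm (u n - z))\<^sup>2 + l / 2 * (\<kappa> * S) \<le> l / 2 * ((norm (x 0 - z))\<^sup>2 + C)"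
      using energy[OF z(1) n] by (simp only: S_def)
    also have "\<dots> \<le> l / 2 * (R + C)"
      using z(3) l_pos by (intro mult_left_mono add_right_mono) (auto simp: norm_minus_commute)
    finally have "l / 2 * ((norm (u n - z))\<^sup>2 + \<kappa> * S) \<le> l / 2 * (R + C)"
      by (simp only: distrib_left)
    then have sum_le: "(norm (u n - z))\<^sup>2 + \<kappa> * S \<le> R + C"
      using l_pos by simp
    have "0 \<le> \<kappa> * S" using \<kappa> S by simp
    then have "norm (u n - z) \<le> sqrt (R + C)"
      using sum_le by (intro real_le_rsqrt) linarith
    moreover have "norm (z - x 0) \<le> sqrt R"
      using z(3) by (rule real_le_rsqrt)
    moreover have "norm (u n - x 0) \<le> norm (u n - z) + norm (z - x 0)"
      using norm_triangle_ineq[of "u n - z" "z - x 0"] by simp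
    moreover have "\<kappa> * S \<le> R + C"
      using sum_le by (smt (verit) zero_le_power2)
    then have "S \<le> (R + C) / \<kappa>"
      using \<kappa> by (simp add: field_simps)
    ultimately show ?thesis
      by (simp add: S_def)
  qed
  show ?thesis
    by (rule exI[of _ "max (sqrt (R + C) + sqrt R) ((R + C) / \<kappa>)"])
      (use both in \<open>auto simp: le_max_iff_disj\<close>)
qed

text \<open>\<open>x\<^sub>k\<^sub>+\<^sub>1\<close> is a convex combination of \<open>u\<^sub>k\<^sub>+\<^sub>1\<close> and \<open>x\<^sub>k\<close>.\<close>

lemma iterates_near_start:
  assumes B: "\<And>k. 1 \<le> k \<Longrightarrow> norm (u k - x 0) \<le> B"
  shows "norm (x k - x 0) \<le> B"
proof (induction k)
  case 0
  show ?case using order_trans[OF norm_ge_zero B[of 1]] by simp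
next
  case (Suc k)
  define T where "T = t (Suc k)"
  have T: "1 \<le> T" using t_ge_1[of "Suc k"] by (simp add: T_def)
  have split: "T *\<^sub>R (x (Suc k) - x 0) = (u (Suc k) - x 0) + (T - 1) *\<^sub>R (x k - x 0)"
    by (simp add: u_def T_def algebra_simps)
  have "T * norm (x (Suc k) - x 0) = norm (T *\<^sub>R (x (Suc k) - x 0))"
    using T by simp
  also have "\<dots> \<le> norm (u (Suc k) - x 0) + norm ((T - 1) *\<^sub>R (x k - x 0))"
    unfolding split by (rule norm_triangle_ineq)
  also have "\<dots> = norm (u (Suc k) - x 0) + (T - 1) * norm (x k - x 0)"
    using T by simp
  also have "\<dots> \<le> B + (T - 1) * B"
    using B[of "Suc k"] Suc T by (intro add_mono mult_left_mono) auto
  also have "\<dots> = T * B"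
    by (simp add: algebra_simps)
  finally show ?case
    using T by simp
qed

lemma \<Delta>_tendsto_0: "\<Delta> \<longlonglongrightarrow> 0"
proof -
  obtain B where B: "\<And>k. 1 \<le> k \<Longrightarrow> norm (u k - x 0) \<le> B"
    using momentum_sum_bounded by blast
  have "norm (x k - x (k - 1)) \<le> 2 * B / t k" if k: "1 \<le> k" for k
  proof -
    have split: "t k *\<^sub>R (x k - x (k - 1)) = (u k - x 0) - (x (k - 1) - x 0)"
      by (simp add: u_def algebra_simps)
    have "t k * norm (x k - x (k - 1)) = norm (t k *\<^sub>R (x k - x (k - 1)))"
      using t_ge_1[OF k] by simp
    also have "\<dots> \<le> norm (u k - x 0) + norm (x (k - 1) - x 0)"
      unfolding split by (rule norm_triangle_ineq4)
    also have "\<dots> \<le> 2 * B"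
      using B[OF k] iterates_near_start[OF B, of "k - 1"] by simp
    finally show ?thesis
      using t_ge_1[OF k] by (simp add: field_simps)
  qed
  then have "\<forall>\<^sub>F k in sequentially. norm (x k - x (k - 1)) \<le> 2 * B / t k"
    by (auto simp: eventually_at_top_linorder)
  moreover have "(\<lambda>k. 2 * B / t k) \<longlonglongrightarrow> 0"
    by (intro real_tendsto_divide_at_top[OF tendsto_const] filterlim_t)
  ultimately have "(\<lambda>k. x k - x (k - 1)) \<longlonglongrightarrow> 0"
    by (rule Lim_null_comparison)
  then have "(\<lambda>k. (norm (x k - x (k - 1)))\<^sup>2) \<longlonglongrightarrow> (norm (0::'a))\<^sup>2"
    by (intro tendsto_intros)
  then show ?thesis
    by (simp add: \<Delta>_def[abs_def])
qed

text \<open>The tail of the sequence stays in the closed set on which every objective is bounded by the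
  inertial energy at time \<open>k\<close>.\<close>

lemma accumulation_point_value:
  assumes r: "strict_mono r" "(x \<circ> r) \<longlonglongrightarrow> xs"
  shows "xs \<in> D" and "1 \<le> k \<Longrightarrow> F i xs \<le> F i (x k) + l / 2 * \<Delta> k"
proof -
  have *: "xs \<in> {z \<in> D. \<forall>i. F i z \<le> F i (x k) + l / 2 * \<Delta> k}" if k: "1 \<le> k" for k
  proof (rule Lim_in_closed_set[OF sublevel_closed _ trivial_limit_sequentially r(2)])
    show "\<forall>\<^sub>F n in sequentially. (x \<circ> r) n \<in> {z \<in> D. \<forall>i. F i z \<le> F i (x k) + l / 2 * \<Delta> k}"
      using eventually_ge_at_top[of k]
    proof eventually_elim
      case (elim n)
      have "F i (x (r n)) \<le> F i (x k) + l / 2 * \<Delta> k" for i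
      proof -
        have "0 \<le> l / 2 * \<Delta> (r n)" using l_pos \<Delta>_nonneg by simp
        then show ?thesis
          using inertial_energy_antimono[OF k, of "r n" i] seq_suble[OF r(1), of n] elim by linarith
      qed
      then show ?case
        by (simp add: x_in)
    qed
  qed
  show "xs \<in> D" using *[of 1] by simp
  show "1 \<le> k \<Longrightarrow> F i xs \<le> F i (x k) + l / 2 * \<Delta> k" using * by blast
qed

text \<open>By \<open>accumulation_point_value\<close>, \<open>comparison\<close> at \<open>z = xs\<close> is an inertial inequality for the squared
  distance from \<open>xs\<close>, up to an error controlled by the \<open>\<Delta>\<close>, and \<open>t * \<Delta>\<close> is summable.\<close>

lemma distance_convergent:
  assumes r: "strict_mono r" "(x \<circ> r) \<longlonglongrightarrow> xs"
  shows "convergent (\<lambda>k. (norm (x k - xs))\<^sup>2)"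
proof -
  obtain B where B: "\<And>n. 1 \<le> n \<Longrightarrow> (\<Sum>k = 1..<n. t k * \<Delta> k) \<le> B"
    using momentum_sum_bounded by blast
  note acc = accumulation_point_value[OF r]
  have step: "(norm (x (Suc k) - xs))\<^sup>2 - (norm (x k - xs))\<^sup>2
      \<le> \<gamma> k * ((norm (x k - xs))\<^sup>2 - (norm (x (k - 1) - xs))\<^sup>2) + (2 * \<Delta> k + \<Delta> (Suc k))"
    if k: "1 \<le> k" for k
  proof -
    have "- (l / 2 * \<Delta> (Suc k)) \<le> \<sigma> (Suc k) xs"
      using acc(2)[of "Suc k"] by (simp add: \<sigma>_ge_iff algebra_simps)
    also note \<sigma>_comparison[OF acc(1), of k]
    finally have "l / 2 * ((norm (xs - x (Suc k)))\<^sup>2 - (norm (xs - y (Suc k)))\<^sup>2) \<le> l / 2 * \<Delta> (Suc k)"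
      by (simp add: algebra_simps)
    then have 1: "(norm (x (Suc k) - xs))\<^sup>2 - (norm (y (Suc k) - xs))\<^sup>2 \<le> \<Delta> (Suc k)"
      using l_pos by (simp add: norm_minus_commute)
    have "y (Suc k) - xs = (1 + \<gamma> k) *\<^sub>R (x k - xs) - ((1 + \<gamma> k) - 1) *\<^sub>R (x (k - 1) - xs)"
      by (simp add: y_Suc[OF k] algebra_simps)
    then have 2: "(norm (y (Suc k) - xs))\<^sup>2 = (1 + \<gamma> k) * (norm (x k - xs))\<^sup>2
        - \<gamma> k * (norm (x (k - 1) - xs))\<^sup>2 + (1 + \<gamma> k) * \<gamma> k * \<Delta> k"
      by (simp only: norm_affine_square) (simp add: \<Delta>_def)
    have "(1 + \<gamma> k) * \<gamma> k \<le> 2 * 1"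
      using \<gamma>_nonneg[OF k] \<gamma>_le_1[OF k] by (intro mult_mono) auto
    then have "(1 + \<gamma> k) * \<gamma> k * \<Delta> k \<le> 2 * \<Delta> k"
      using \<Delta>_nonneg by (intro mult_right_mono) auto
    then show ?thesis
      using 1 unfolding 2 by (simp add: algebra_simps)
  qed
  have sum: "(\<Sum>k = 1..<n. t (Suc k) * (2 * \<Delta> k + \<Delta> (Suc k))) \<le> 5 * B" for n
  proof (cases "1 \<le> n")
    case True
    have "(\<Sum>k = 1..<n. t (Suc k) * (2 * \<Delta> k + \<Delta> (Suc k)))
        \<le> (\<Sum>k = 1..<n. 4 * (t k * \<Delta> k) + t (Suc k) * \<Delta> (Suc k))"
    proof (rule sum_mono)
      fix k assume "k \<in> {1..<n}"
      then have k: "1 \<le> k" by simp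
      have "t (Suc k) * (2 * \<Delta> k) \<le> (2 * t k) * (2 * \<Delta> k)"
        using t_step_le[OF k] t_ge_1[OF k] \<Delta>_nonneg by (intro mult_right_mono) auto
      then show "t (Suc k) * (2 * \<Delta> k + \<Delta> (Suc k)) \<le> 4 * (t k * \<Delta> k) + t (Suc k) * \<Delta> (Suc k)"
        by (simp add: algebra_simps)
    qed
    also have "\<dots> = 4 * (\<Sum>k = 1..<n. t k * \<Delta> k) + (\<Sum>k = 1..<n. t (Suc k) * \<Delta> (Suc k))"
      by (simp add: sum.distrib sum_distrib_left)
    also have "(\<Sum>k = 1..<n. t (Suc k) * \<Delta> (Suc k)) = (\<Sum>k = 2..<Suc n. t k * \<Delta> k)"
      by (simp only: numeral_2_eq_2 One_nat_def sum.shift_bounds_Suc_ivl)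
    also have "\<dots> \<le> (\<Sum>k = 1..<Suc n. t k * \<Delta> k)"
      by (intro sum_mono2 mult_nonneg_nonneg \<Delta>_nonneg order_trans[OF _ t_ge_1]) auto
    finally show ?thesis
      using B[OF True] B[of "Suc n"] by linarith
  qed (use B[of 1] in simp)
  show ?thesis
    by (rule inertial_inequality_convergent[OF _ _ step sum]) (auto simp: \<Delta>_nonneg)
qed

text \<open>The energy bound gives \<open>t\<^sub>n\<^sup>2 \<sigma>\<^sub>n(z) \<le> K\<close> for every fixed \<open>z\<close> at which \<open>\<sigma>\<^sub>n(z)\<close> is positive, whereas a
  point \<open>z\<close> that is strictly better than \<open>xs\<close> in all objectives would keep \<open>\<sigma>\<^sub>n(z)\<close> above a positive constant.\<close>

lemma limit_not_dominated:
  assumes r: "strict_mono r" "(x \<circ> r) \<longlonglongrightarrow> xs" and z: "z \<in> D"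
  shows "\<exists>i. F i xs \<le> F i z"
proof (rule ccontr)
  assume "\<not> ?thesis"
  then have less: "F i z < F i xs" for i
    by (simp add: not_le)
  define \<epsilon> where "\<epsilon> = (MIN i. F i xs - F i z)"
  have \<epsilon>: "0 < \<epsilon>"
    using less by (simp add: \<epsilon>_def)
  have \<epsilon>_le: "\<epsilon> \<le> F i xs - F i z" for i
    unfolding \<epsilon>_def by (rule Min_le) auto
  obtain \<kappa> C where \<kappa>: "0 < \<kappa>"
    and energy: "\<And>z n. z \<in> D \<Longrightarrow> 1 \<le> n \<Longrightarrow>
      G n z + l / 2 * (\<kappa> * (\<Sum>k = 1..<n. t k * \<Delta> k)) \<le> l / 2 * ((norm (x 0 - z))\<^sup>2 + C)"
    using energy_bound by blast
  define K where "K = l / 2 * ((norm (x 0 - z))\<^sup>2 + C)"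
  have upper: "\<sigma> n z \<le> \<epsilon> / 2 \<or> t n * \<epsilon> / 2 \<le> K" if n: "1 \<le> n" for n
  proof (rule disjCI)
    assume not: "\<not> t n * \<epsilon> / 2 \<le> K"
    have tn: "1 \<le> t n" using t_ge_1[OF n] .
    have "0 \<le> l / 2 * (\<kappa> * (\<Sum>k = 1..<n. t k * \<Delta> k))"
      using l_pos \<kappa>
      by (intro mult_nonneg_nonneg sum_nonneg \<Delta>_nonneg order_trans[OF _ t_ge_1]) auto
    moreover have "0 \<le> l / 2 * (norm (u n - z))\<^sup>2" "0 \<le> l / 2 * s n * \<Delta> n"
      using l_pos s_nonneg[of n] \<Delta>_nonneg[of n] by auto
    ultimately have le: "((t n)\<^sup>2 + s n) * \<sigma> n z \<le> K"
      using energy[OF z n] unfolding G_def K_def by linarith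
    show "\<sigma> n z \<le> \<epsilon> / 2"
    proof (rule ccontr)
      assume "\<not> \<sigma> n z \<le> \<epsilon> / 2"
      then have "t n * (\<epsilon> / 2) \<le> ((t n)\<^sup>2 + s n) * \<sigma> n z"
        using tn \<epsilon> s_nonneg[of n] self_le_power[OF tn, of 2] by (intro mult_mono) auto
      then show False
        using le not by simp
    qed
  qed
  have "\<forall>\<^sub>F n in sequentially. 2 * (K + 1) / \<epsilon> \<le> t n"
    using filterlim_t by (simp add: filterlim_at_top)
  moreover have "(\<lambda>n. l / 2 * \<Delta> n) \<longlonglongrightarrow> l / 2 * 0"
    by (intro tendsto_intros \<Delta>_tendsto_0)
  then have "\<forall>\<^sub>F n in sequentially. l / 2 * \<Delta> n < \<epsilon> / 2"
    by (rule order_tendstoD(2)) (use \<epsilon> in simp)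
  ultimately have "\<forall>\<^sub>F n in sequentially. False"
    using eventually_ge_at_top[of "1::nat"]
  proof eventually_elim
    case (elim n)
    have "\<epsilon> - l / 2 * \<Delta> n \<le> \<sigma> n z"
      unfolding \<sigma>_ge_iff
    proof
      fix i show "\<epsilon> - l / 2 * \<Delta> n \<le> F i (x n) - F i z"
        using accumulation_point_value(2)[OF r elim(3), of i] \<epsilon>_le[of i] by linarith
    qed
    moreover have "K + 1 \<le> t n * \<epsilon> / 2"
      using elim(1) \<epsilon> by (simp add: field_simps)
    ultimately show False
      using upper[OF elim(3)] elim(2) by linarith
  qed
  then show False
    by simp
qed

theorem converges:
  "\<exists>xs\<in>D. x \<longlonglongrightarrow> xs \<and> (\<forall>z\<in>D. \<exists>i. F i xs \<le> F i z)"
proof -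
  obtain B where "\<And>k. 1 \<le> k \<Longrightarrow> norm (u k - x 0) \<le> B"
    using momentum_sum_bounded by blast
  then have "x k \<in> cball (x 0) B" for k
    using iterates_near_start[of B k] by (simp add: dist_norm norm_minus_commute)
  then obtain xs r where r: "strict_mono r" "(x \<circ> r) \<longlonglongrightarrow> xs"
    using compact_cball[of "x 0" B] unfolding compact_def by metis
  obtain h where h: "(\<lambda>k. (norm (x k - xs))\<^sup>2) \<longlonglongrightarrow> h"
    using distance_convergent[OF r] by (auto simp: convergent_def)
  have "(\<lambda>n. (norm ((x \<circ> r) n - xs))\<^sup>2) \<longlonglongrightarrow> (norm (xs - xs))\<^sup>2"
    by (intro tendsto_intros r)
  moreover have "(\<lambda>n. (norm ((x \<circ> r) n - xs))\<^sup>2) \<longlonglongrightarrow> h"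
    using LIMSEQ_subseq_LIMSEQ[OF h r(1)] by (simp add: o_def)
  ultimately have "(norm (xs - xs))\<^sup>2 = h"
    by (rule LIMSEQ_unique)
  then have "h = 0"
    by simp
  then have "(\<lambda>k. sqrt ((norm (x k - xs))\<^sup>2)) \<longlonglongrightarrow> sqrt 0"
    using h by (intro tendsto_real_sqrt) simp
  then have "x \<longlonglongrightarrow> xs"
    by (simp add: tendsto_norm_zero_iff LIM_zero_iff)
  then show ?thesis
    using accumulation_point_value(1)[OF r] limit_not_dominated[OF r] by blast
qed

end

section \<open>Convergence to a weakly Pareto optimal point\<close>

text \<open>The supremum in the assumption ranges over objective values; only an objective vector, not the
  dominating point itself, is known to have a preimage near the start. Any such preimage dominates
  equally well.\<close>

lemma assumption_B_dominating:
  assumes g: "\<And>i. proper_fun (g i)" and B: "assumption_B (objective f g) x0"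
    and x0: "x0 \<in> domain (objective f g)"
  shows "\<exists>R. \<forall>w\<in>domain (objective f g). (\<forall>i. fval f g i w \<le> fval f g i x0) \<longrightarrow>
    (\<exists>z\<in>domain (objective f g). (\<forall>i. fval f g i z \<le> fval f g i w) \<and> (norm (z - x0))\<^sup>2 \<le> R)"
proof -
  let ?F = "objective f g"
  let ?X = "weakly_pareto ?F \<inter> level_set ?F (?F x0)"
  have "(SUP Fs\<in>?F ` ?X. INF z\<in>?F -` {Fs}. ereal ((norm (z - x0))\<^sup>2)) < \<infinity>"
    using B by (simp add: assumption_B_def)
  then obtain R :: real where R:
    "(SUP Fs\<in>?F ` ?X. INF z\<in>?F -` {Fs}. ereal ((norm (z - x0))\<^sup>2)) < ereal R"
    using less_PInf_Ex_of_nat by auto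
  have "\<exists>z\<in>domain ?F. (\<forall>i. fval f g i z \<le> fval f g i w) \<and> (norm (z - x0))\<^sup>2 \<le> R"
    if w: "w \<in> domain ?F" and le: "\<And>i. fval f g i w \<le> fval f g i x0" for w
  proof -
    have Fw: "?F w \<le> ?F x0"
      using le by (simp add: le_fun_def objective_eq_fval[OF g w] objective_eq_fval[OF g x0])
    then obtain xs where xs: "xs \<in> weakly_pareto ?F" "?F xs \<le> ?F w"
      using B unfolding assumption_B_def level_set_def by blast
    then have "?F xs \<in> ?F ` ?X"
      using Fw order_trans[OF xs(2) Fw] by (auto simp: level_set_def)
    then have "(INF z\<in>?F -` {?F xs}. ereal ((norm (z - x0))\<^sup>2)) < ereal R"
      by (rule le_less_trans[OF SUP_upper R])
    then obtain z where z: "?F z = ?F xs" "ereal ((norm (z - x0))\<^sup>2) < ereal R"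
      unfolding INF_less_iff by blast
    have zw: "?F z i \<le> ?F w i" for i
      using xs(2) z(1) by (simp add: le_fun_def)
    have "?F w i < \<infinity>" for i
      using w by (simp add: domain_def)
    then have zD: "z \<in> domain ?F"
      unfolding domain_def using le_less_trans[OF zw] by blast
    have "fval f g i z \<le> fval f g i w" for i
      using zw[of i] by (simp add: objective_eq_fval[OF g w] objective_eq_fval[OF g zD])
    then show ?thesis
      using zD z(2) by (intro bexI[of _ z]) auto
  qed
  then show ?thesis
    by blast
qed

theorem theorem12:
  fixes f :: "'m::finite \<Rightarrow> real ^ 'n \<Rightarrow> real"
    and df :: "'m \<Rightarrow> real ^ 'n \<Rightarrow> real ^ 'n"
    and g :: "'m \<Rightarrow> real ^ 'n \<Rightarrow> ereal"
    and L :: "'m \<Rightarrow> real"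
    and l a b :: real
    and x y :: "nat \<Rightarrow> real ^ 'n"
    and t :: "nat \<Rightarrow> real"
  assumes "\<And>i. convex_on UNIV (f i)"
    and "\<And>i z. GDERIV (f i) z :> df i z"
    and "\<And>i. continuous_on UNIV (df i)"
    and "\<And>i. L i > 0"
    and "\<And>i. (L i)-lipschitz_on UNIV (df i)"
    and "\<And>i. closed_fun (g i)"
    and "\<And>i. proper_fun (g i)"
    and "\<And>i. convex_fun (g i)"
    and "0 < a" "a < 1"
    and "a\<^sup>2 / 4 \<le> b" "b \<le> 1 / 4"
    and "l \<ge> (MAX i. L i)"
    and "accelerated_prox_grad f df g l a b x y t"
    and "assumption_B (objective f g) (x 0)"
  shows "bounded (range x) \<and>
         (\<exists>z r. strict_mono r \<and> (x \<circ> r) \<longlonglongrightarrow> z) \<and>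
         (\<exists>xs\<in>weakly_pareto (objective f g). x \<longlonglongrightarrow> xs)"
proof -
  let ?D = "domain (objective f g)"
  let ?F = "fval f g"
  note f = assms(1,2,5) and g = assms(6-8)
  have L_le: "L i \<le> l" for i
    using assms(13) by (simp add: Max_le_iff)
  have l: "0 < l"
    using less_le_trans[OF assms(4) L_le] .
  have x0: "x 0 \<in> ?D" and y1: "y 1 = x 0" and t1: "t 1 = 1"
    using assms(14) by (simp_all add: accelerated_prox_grad_def)
  have x_Suc: "x (Suc k) = prox_step f df g l (x k) (y (Suc k))" for k
    using assms(14) unfolding accelerated_prox_grad_def
    by (metis diff_Suc_1 le_add1 plus_1_eq_Suc)
  have t_Suc: "t (Suc k) = sqrt ((t k)\<^sup>2 - a * t k + b) + 1 / 2"
    and y_Suc: "y (Suc k) = x k + ((t k - 1) / t (Suc k)) *\<^sub>R (x k - x (k - 1))"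
    if "1 \<le> k" for k
    using assms(14) that by (simp_all add: accelerated_prox_grad_def)
  have x_in: "x k \<in> ?D" for k
  proof (induction k)
    case (Suc k)
    then show ?case
      by (rule prox_step_descent(1)[OF f g L_le l _ x_Suc])
  qed (rule x0)
  note prox = prox_step_descent(2)[OF f g L_le l x_in x_Suc]
  interpret momentum a b t
    using assms(9-12) t1 t_Suc by unfold_locales
  interpret accelerated_descent a b t ?F ?D l x y
  proof unfold_locales
    show "y (Suc k) = x k + \<gamma> k *\<^sub>R (x k - x (k - 1))" if "1 \<le> k" for k
      using y_Suc[OF that] by (simp add: \<gamma>_def)
    show "?F i (x (Suc k)) - ?F i (x k)
      \<le> l / 2 * ((norm (x k - y (Suc k)))\<^sup>2 - (norm (x k - x (Suc k)))\<^sup>2)" for i k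
    proof -
      have "?F i (x (Suc k)) - ?F i (x k) + l / 2 * (norm (x k - x (Suc k)))\<^sup>2
          \<le> 0 + l / 2 * (norm (x k - y (Suc k)))\<^sup>2"
        by (rule prox[OF x_in]) simp
      then show ?thesis
        by (simp add: right_diff_distrib)
    qed
    show "\<exists>i. ?F i (x (Suc k)) - ?F i z
      \<le> l / 2 * ((norm (z - y (Suc k)))\<^sup>2 - (norm (z - x (Suc k)))\<^sup>2)" if z: "z \<in> ?D" for k z
    proof -
      \<comment> \<open>the objective with the largest increment from the iterate to \<open>z\<close> is the one to compare\<close>
      define h where "h i = ?F i z - ?F i (x k)" for i
      obtain i where i: "(MAX j. h j) = h i"
        by (rule Max_range_attained)
      have "h j \<le> h i" for j
        unfolding i[symmetric] by (rule Max_ge) auto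
      then have "?F i (x (Suc k)) - ?F i (x k) + l / 2 * (norm (z - x (Suc k)))\<^sup>2
          \<le> h i + l / 2 * (norm (z - y (Suc k)))\<^sup>2"
        by (intro prox z) (simp add: h_def)
      then show ?thesis
        by (intro exI[of _ i]) (simp add: h_def right_diff_distrib)
    qed
    show "closed {z \<in> ?D. \<forall>i. ?F i z \<le> c i}" for c
      by (rule closed_sublevel[OF f(2) g(1,2)])
    show "\<exists>R. \<forall>w\<in>?D. (\<forall>i. ?F i w \<le> ?F i (x 0)) \<longrightarrow>
        (\<exists>z\<in>?D. (\<forall>i. ?F i z \<le> ?F i w) \<and> (norm (z - x 0))\<^sup>2 \<le> R)"
      by (rule assumption_B_dominating[OF g(2) assms(15) x0])
  qed (use l x_in y1 in auto)
  obtain xs where xs: "xs \<in> ?D" "x \<longlonglongrightarrow> xs" "\<And>z. z \<in> ?D \<Longrightarrow> \<exists>i. ?F i xs \<le> ?F i z"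
    using converges by blast
  have "xs \<in> weakly_pareto (objective f g)"
    unfolding weakly_pareto_def mem_Collect_eq
  proof
    assume "\<exists>z. strict_all (objective f g z) (objective f g xs)"
    then obtain z where z: "\<And>i. objective f g z i < objective f g xs i"
      by (auto simp: strict_all_def)
    have "objective f g z i < \<infinity>" for i
      by (rule less_le_trans[OF z]) simp
    then have zD: "z \<in> ?D"
      by (simp add: domain_def)
    then have "?F i z < ?F i xs" for i
      using z[of i] by (simp add: objective_eq_fval[OF g(2) zD] objective_eq_fval[OF g(2) xs(1)])
    then show False
      using xs(3)[OF zD] by (meson not_le)
  qed
  moreover have "bounded (range x)"
    using xs(2) by (rule convergent_imp_bounded)
  moreover have "\<exists>z r. strict_mono r \<and> (x \<circ> r) \<longlonglongrightarrow> z"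
    using xs(2) by (intro exI[of _ xs] exI[of _ id]) (simp add: strict_mono_id)
  ultimately show ?thesis
    using xs(2) by blast
qed

end
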